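(* Let $\dim\mathcal{H}=2$ with orthonormal basis $e_1,e_2$, let $0<q<1$ and let $\lambda\in\mathbb{C}$ with $|\lambda|=1$. Let $T:\mathcal{H}^{\otimes2}\to\mathcal{H}^{\otimes2}$ be the linear operator defined by $$T(e_i\otimes e_i)=q\,e_i\otimes e_i\ (i=1,2),\qquad T(e_1\otimes e_2)=\overline{\lambda}\,e_2\otimes e_1,\qquad T(e_2\otimes e_1)=\lambda\, e_1\otimes e_2 .$$ Then for every $m\ge2$ one has $\ker R_m=\mathcal{K}_m$, and this subspace generates the largest homogeneous Wick ideal of degree $m$.
   Context: The Wick algebra associated with this $T$ is the unital $*$-algebra $\mathcal{A}_2^q$ generated by $a_1,a_2,a_1^*,a_2^*$ with relations $a_i^*a_i=1+q\,a_ia_i^*$ ($i=1,2$) and $a_1^*a_2=\lambda a_2a_1^*$. Identify $e_i$ with $a_i$ and $e_i^*$ (basis of the formal dual $\mathcal{H}^*$) with $a_i^*$; the product of $\mathcal{A}_2^q$ is then written $\otimes$, and the full tensor algebras $\mathcal{T}(\mathcal{H})$, $\mathcal{T}(\mathcal{H}^* )$ are the subalgebras generated by the $a_i$, respectively by the $a_i^*$. For subspaces $U,V$, $U\otimes V$ is the linear span of all products $u\otimes v$. A two-sided ideal $\mathcal{I}\subset\mathcal{T}(\mathcal{H})$ is a Wick ideal if $\mathcal{T}(\mathcal{H}^* )\otimes\mathcal{I}\subset\mathcal{I}\otimes\mathcal{T}(\mathcal{H}^* )$ in $\mathcal{A}_2^q$. If $\mathcal{I}$ is generated, as a two-sided ideal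 of $\mathcal{T}(\mathcal{H})$, by a subspace $\mathcal{I}_0\subset\mathcal{H}^{\otimes n}$, it is called a homogeneous Wick ideal of degree $n$ (and by abuse one calls $\mathcal{I}_0$ itself so). The largest homogeneous Wick ideal of degree $n$ is the one containing every homogeneous Wick ideal of degree $n$. On a tensor power of $\mathcal{H}$, $T_i$ denotes $T$ acting in the $i$-th and $(i+1)$-st tensor factors and the identity elsewhere. For $n\ge2$, $R_n=\mathbf{1}_{\mathcal{H}^{\otimes n}}+T_1+T_1T_2+\cdots+T_1T_2\cdots T_{n-1}$ on $\mathcal{H}^{\otimes n}$. Put $\mathcal{K}_2=\ker R_2$ and $\mathcal{K}_{m+1}=(\mathbf{1}_{\mathcal{H}^{\otimes(m+1)}}-T_1T_2\cdots T_m)(\mathcal{K}_m\otimes\mathcal{H})$ for $m\ge2$. *)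

theory Defs
  imports Complex_Main "HOL-Library.Poly_Mapping" "HOL-Algebra.Algebraic_Closure_Type"
    "HOL-Algebra.Generated_Rings" "HOL-Algebra.Embedded_Algebras"
begin

section \<open>Free algebras over the complex numbers\<close>

text \<open>
  The free unital algebra on a set of letters is realised as the monoid algebra of the free monoid
  of words: its elements are finitely supported functions from words to complex numbers and the
  product of \<^typ>\<open>'a \<Rightarrow>\<^sub>0 'b\<close> is convolution, i.e. it extends concatenation of words bilinearly.
\<close>

datatype 'a free_monoid = FM (letters: "'a list")

instantiation free_monoid :: (type) monoid_add
begin

definition zero_free_monoid :: "'a free_monoid" where
  "0 = FM []"

definition plus_free_monoid :: "'a free_monoid \<Rightarrow> 'a free_monoid \<Rightarrow> 'a free_monoid" where
  "u + v = FM (letters u @ letters v)"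

instance
  by standard (simp_all add: zero_free_monoid_def plus_free_monoid_def)

end

type_synonym 'a free_alg = "'a free_monoid \<Rightarrow>\<^sub>0 complex"

definition monomial :: "'a list \<Rightarrow> 'a free_alg" where
  "monomial w = Poly_Mapping.single (FM w) 1"

definition scal :: "complex \<Rightarrow> 'a free_alg \<Rightarrow> 'a free_alg" where
  "scal c = Poly_Mapping.map ((*) c)"

lemma lookup_scal: "Poly_Mapping.lookup (scal c x) w = c * Poly_Mapping.lookup x w"
  by (simp add: scal_def Poly_Mapping.map.rep_eq when_def)

global_interpretation free_alg: vector_space scal
  by standard (auto intro!: poly_mapping_eqI simp: lookup_scal lookup_add algebra_simps)

text \<open>The linear map sending the basis element \<^term>\<open>monomial w\<close> to \<open>f w\<close>:\<close>

definition lin_ext :: "('a list \<Rightarrow> 'b free_alg) \<Rightarrow> 'a free_alg \<Rightarrow> 'b free_alg" where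
  "lin_ext f x = (\<Sum>w \<in> Poly_Mapping.keys x. scal (Poly_Mapping.lookup x w) (f (letters w)))"

section \<open>The operators on tensor powers\<close>

text \<open>
  \<open>\<H>\<close> has the basis \<open>e\<^sub>1, e\<^sub>2\<close>, so \<open>\<T>(\<H>)\<close> is \<^typ>\<open>'a free_alg\<close> with \<open>'a\<close> the two-element
  index type below; its product is the tensor product, and the monomial of the word \<open>i\<^sub>1 \<dots> i\<^sub>n\<close> is
  \<open>e\<^bsub>i\<^sub>1\<^esub> \<otimes> \<dots> \<otimes> e\<^bsub>i\<^sub>n\<^esub>\<close>.
\<close>

datatype index = I1 | I2

type_synonym tensor = "index free_alg"

definition tensor_power :: "nat \<Rightarrow> tensor set" where
  "tensor_power n = {x. \<forall>w \<in> Poly_Mapping.keys x. length (letters w) = n}"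

text \<open>\<open>T_basis q l i j\<close> is \<open>T(e\<^sub>i \<otimes> e\<^sub>j)\<close>; the parameter \<open>l\<close> stands for \<open>\<lambda>\<close>.\<close>

fun T_basis :: "real \<Rightarrow> complex \<Rightarrow> index \<Rightarrow> index \<Rightarrow> tensor" where
  "T_basis q l I1 I1 = scal (of_real q) (monomial [I1, I1])"
| "T_basis q l I2 I2 = scal (of_real q) (monomial [I2, I2])"
| "T_basis q l I1 I2 = scal (cnj l) (monomial [I2, I1])"
| "T_basis q l I2 I1 = scal l (monomial [I1, I2])"

text \<open>
  \<open>T_at q l i\<close> is \<open>T\<^sub>i\<close>, with tensor factors counted from 1 while lists are indexed from 0. It is only
  meaningful on \<open>tensor_power n\<close> with \<open>1 \<le> i < n\<close>.
\<close>

definition T_at :: "real \<Rightarrow> complex \<Rightarrow> nat \<Rightarrow> tensor \<Rightarrow> tensor" where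
  "T_at q l i =
    lin_ext (\<lambda>w. monomial (take (i - 1) w) * T_basis q l (w ! (i - 1)) (w ! i)
                   * monomial (drop (i + 1) w))"

text \<open>\<open>T_prod q l k\<close> is \<open>T\<^sub>1 T\<^sub>2 \<cdots> T\<^sub>k\<close>; in particular the rightmost factor acts first.\<close>

primrec T_prod :: "real \<Rightarrow> complex \<Rightarrow> nat \<Rightarrow> tensor \<Rightarrow> tensor" where
  "T_prod q l 0 = id"
| "T_prod q l (Suc k) = T_prod q l k \<circ> T_at q l (Suc k)"

definition R_op :: "real \<Rightarrow> complex \<Rightarrow> nat \<Rightarrow> tensor \<Rightarrow> tensor" where
  "R_op q l n x = (\<Sum>k<n. T_prod q l k x)"

definition ker_R :: "real \<Rightarrow> complex \<Rightarrow> nat \<Rightarrow> tensor set" where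
  "ker_R q l n = {x \<in> tensor_power n. R_op q l n x = 0}"

definition tensor_prod :: "tensor set \<Rightarrow> tensor set \<Rightarrow> tensor set" where
  "tensor_prod U V = free_alg.span {u * v |u v. u \<in> U \<and> v \<in> V}"

text \<open>\<open>\<K>\<^sub>m\<close> is only defined for \<open>m \<ge> 2\<close>; the values at 0 and 1 are junk.\<close>

fun K_space :: "real \<Rightarrow> complex \<Rightarrow> nat \<Rightarrow> tensor set" where
  "K_space q l 0 = {0}"
| "K_space q l (Suc 0) = {0}"
| "K_space q l (Suc (Suc 0)) = ker_R q l 2"
| "K_space q l (Suc (Suc (Suc m))) =
    (\<lambda>x. x - T_prod q l (m + 2) x) ` tensor_prod (K_space q l (m + 2)) (tensor_power 1)"

section \<open>The Wick algebra\<close>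

text \<open>\<open>Cr i\<close> and \<open>An i\<close> are the generators \<open>a\<^sub>i\<close> and \<open>a\<^sub>i\<^sup>*\<close>.\<close>

datatype gen = Cr index | An index

abbreviation gen_a :: "index \<Rightarrow> gen free_alg" where
  "gen_a i \<equiv> monomial [Cr i]"

abbreviation gen_a_star :: "index \<Rightarrow> gen free_alg" where
  "gen_a_star i \<equiv> monomial [An i]"

fun gen_star :: "gen \<Rightarrow> gen" where
  "gen_star (Cr i) = An i"
| "gen_star (An i) = Cr i"

text \<open>The involution of the free \<open>*\<close>-algebra: conjugate-linear and antimultiplicative.\<close>

definition star :: "gen free_alg \<Rightarrow> gen free_alg" where
  "star x = (\<Sum>w \<in> Poly_Mapping.keys x.
     scal (cnj (Poly_Mapping.lookup x w)) (monomial (rev (map gen_star (letters w)))))"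

abbreviation free_ring :: "gen free_alg ring" where
  "free_ring \<equiv> ring_of_type_algebra"

definition wick_relations :: "real \<Rightarrow> complex \<Rightarrow> gen free_alg set" where
  "wick_relations q l =
     {gen_a_star i * gen_a i - (1 + scal (of_real q) (gen_a i * gen_a_star i)) |i. True}
     \<union> {gen_a_star I1 * gen_a I2 - scal l (gen_a I2 * gen_a_star I1)}"

text \<open>
  As the Wick algebra is presented as a \<open>*\<close>-algebra, one factors out the smallest \<open>*\<close>-closed
  two-sided ideal; it also contains the adjoint relation
  \<open>a\<^sub>2\<^sup>* a\<^sub>1 = cnj \<lambda> a\<^sub>1 a\<^sub>2\<^sup>*\<close>. (Ideals of a unital algebra are automatically linear subspaces.)
\<close>

definition relation_ideal :: "real \<Rightarrow> complex \<Rightarrow> gen free_alg set" where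
  "relation_ideal q l = (\<lambda>J. ideal J free_ring \<and> star ` J \<subseteq> J) hull wick_relations q l"

definition wick_algebra :: "real \<Rightarrow> complex \<Rightarrow> gen free_alg set ring" where
  "wick_algebra q l = free_ring Quot relation_ideal q l"

definition wick_class :: "real \<Rightarrow> complex \<Rightarrow> gen free_alg \<Rightarrow> gen free_alg set" where
  "wick_class q l x = relation_ideal q l +>\<^bsub>free_ring\<^esub> x"

definition scalars :: "real \<Rightarrow> complex \<Rightarrow> gen free_alg set set" where
  "scalars q l = {wick_class q l (scal c 1) |c. True}"

text \<open>The unital subalgebras generated by the \<open>a\<^sub>i\<close>, respectively by the \<open>a\<^sub>i\<^sup>*\<close>.\<close>

definition TH :: "real \<Rightarrow> complex \<Rightarrow> gen free_alg set set" where
  "TH q l = generate_ring (wick_algebra q l) (scalars q l \<union> range (\<lambda>i. wick_class q l (gen_a i)))"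

definition TH_star :: "real \<Rightarrow> complex \<Rightarrow> gen free_alg set set" where
  "TH_star q l = generate_ring (wick_algebra q l) (scalars q l \<union> range (\<lambda>i. wick_class q l (gen_a_star i)))"

abbreviation TH_ring :: "real \<Rightarrow> complex \<Rightarrow> gen free_alg set ring" where
  "TH_ring q l \<equiv> wick_algebra q l \<lparr>carrier := TH q l\<rparr>"

text \<open>
  \<open>U \<otimes> V\<close> inside the Wick algebra. The library's \<^const>\<open>subalgebra\<close> \<open>K W R\<close> says that \<open>W\<close> is a
  \<open>K\<close>-linear subspace of \<open>R\<close> (no closure under products), so the hull is the linear span.
\<close>

definition wick_prod ::
  "real \<Rightarrow> complex \<Rightarrow> gen free_alg set set \<Rightarrow> gen free_alg set set \<Rightarrow> gen free_alg set set" where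
  "wick_prod q l U V =
     (\<lambda>W. subalgebra (scalars q l) W (wick_algebra q l)) hull
       {u \<otimes>\<^bsub>wick_algebra q l\<^esub> v |u v. u \<in> U \<and> v \<in> V}"

section \<open>Wick ideals\<close>

definition wick_ideal :: "real \<Rightarrow> complex \<Rightarrow> gen free_alg set set \<Rightarrow> bool" where
  "wick_ideal q l I \<longleftrightarrow>
     ideal I (TH_ring q l) \<and> wick_prod q l (TH_star q l) I \<subseteq> wick_prod q l I (TH_star q l)"

text \<open>The identification of \<open>e\<^sub>i\<close> with \<open>a\<^sub>i\<close>:\<close>

definition wick_embed :: "real \<Rightarrow> complex \<Rightarrow> tensor \<Rightarrow> gen free_alg set" where
  "wick_embed q l x = wick_class q l (lin_ext (\<lambda>w. monomial (map Cr w)) x)"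

definition generated_ideal :: "real \<Rightarrow> complex \<Rightarrow> tensor set \<Rightarrow> gen free_alg set set" where
  "generated_ideal q l I0 = Idl\<^bsub>TH_ring q l\<^esub> (wick_embed q l ` I0)"

definition homogeneous_wick_ideal ::
  "real \<Rightarrow> complex \<Rightarrow> nat \<Rightarrow> gen free_alg set set \<Rightarrow> bool" where
  "homogeneous_wick_ideal q l n I \<longleftrightarrow>
     wick_ideal q l I \<and>
     (\<exists>I0. I0 \<subseteq> tensor_power n \<and> free_alg.subspace I0 \<and> I = generated_ideal q l I0)"

definition largest_homogeneous_wick_ideal ::
  "real \<Rightarrow> complex \<Rightarrow> nat \<Rightarrow> gen free_alg set set \<Rightarrow> bool" where
  "largest_homogeneous_wick_ideal q l n I \<longleftrightarrow>
     homogeneous_wick_ideal q l n I \<and> (\<forall>I'. homogeneous_wick_ideal q l n I' \<longrightarrow> I' \<subseteq> I)"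

end

theory Submission
  imports Defs
begin

text \<open>
  Let \<open>D\<^sub>i\<close> be the skew derivations of \<open>\<T>(\<H>)\<close> with \<open>D\<^sub>i(e\<^sub>j) = \<delta>\<^sub>i\<^sub>j\<close> and
  \<open>D\<^sub>i(x y) = D\<^sub>i(x) y + \<sigma>\<^sub>i(x) D\<^sub>i(y)\<close>, where the diagonal automorphisms \<open>\<sigma>\<^sub>i\<close> encode the coefficients of \<open>T\<close>. Then
  \<open>R\<^sub>n x = e\<^sub>1 D\<^sub>1(x) + e\<^sub>2 D\<^sub>2(x)\<close>, so \<open>ker R\<^sub>n\<close> consists of the elements of degree \<open>n\<close> killed by both
  derivations. Since \<open>T\<^sub>1 \<cdots> T\<^sub>n (x e\<^sub>j) = e\<^sub>j \<sigma>\<^sub>j(x)\<close>, this operator is a weighted cyclic shift on words; for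
  \<open>n \<ge> 2\<close> every word of length \<open>n + 1\<close> repeats a letter, which makes the product of the weights along its
  orbit have modulus less than 1, so \<open>1 - T\<^sub>1 \<cdots> T\<^sub>n\<close> is bijective. This, with the analogous fact for the
  shift obtained after applying \<open>D\<^sub>i\<close>, gives \<open>ker R\<^sub>n\<^sub>+\<^sub>1 = (1 - T\<^sub>1 \<cdots> T\<^sub>n)(ker R\<^sub>n \<otimes> \<H>)\<close>.

  In the Wick algebra \<open>a\<^sub>i\<^sup>* x = D\<^sub>i(x) + \<sigma>\<^sub>i(x) a\<^sub>i\<^sup>*\<close>, and \<open>ker R\<^sub>m\<close> is \<open>\<sigma>\<^sub>i\<close>-stable, hence generates a Wick
  ideal. Conversely, if \<open>x\<close> is a generator of a homogeneous Wick ideal of degree \<open>m\<close>, then applying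
  \<open>a\<^sub>i\<^sup>* x\<close> to the vacuum of the Fock representation shows that \<open>D\<^sub>i(x)\<close>, of degree \<open>m - 1\<close>, lies in that ideal, so
  \<open>D\<^sub>i(x) = 0\<close>.
\<close>

section \<open>Linear maps and monomials\<close>

lemma lookup_monomial: "Poly_Mapping.lookup (monomial w) u = (if letters u = w then 1 else 0)"
  by (cases u) (auto simp: monomial_def lookup_single when_def)

lemma free_alg_expand:
  "x = (\<Sum>w\<in>Poly_Mapping.keys x. scal (Poly_Mapping.lookup x w) (monomial (letters w)))"
proof (rule poly_mapping_eqI)
  fix k
  have "(\<Sum>w\<in>Poly_Mapping.keys x. Poly_Mapping.lookup x w * (if letters k = letters w then 1 else 0))
      = (\<Sum>w\<in>Poly_Mapping.keys x. if w = k then Poly_Mapping.lookup x w else 0)"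
    by (intro sum.cong refl) (auto simp: free_monoid.expand)
  also have "\<dots> = Poly_Mapping.lookup x k"
    by (simp add: sum.delta in_keys_iff)
  finally show "Poly_Mapping.lookup x k = Poly_Mapping.lookup
      (\<Sum>w\<in>Poly_Mapping.keys x. scal (Poly_Mapping.lookup x w) (monomial (letters w))) k"
    by (simp add: lookup_sum lookup_scal lookup_monomial)
qed

lemma tensor_power_induct [consumes 1, case_names zero add mono]:
  assumes "x \<in> tensor_power n"
    and "P 0" and "\<And>x y. P x \<Longrightarrow> P y \<Longrightarrow> P (x + y)"
    and "\<And>c w. length w = n \<Longrightarrow> P (scal c (monomial w))"
  shows "P x"
proof -
  have "P (\<Sum>w\<in>A. scal (Poly_Mapping.lookup x w) (monomial (letters w)))"
    if "finite A" "A \<subseteq> Poly_Mapping.keys x" for A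
    using that by (induct A) (use assms in \<open>auto simp: tensor_power_def\<close>)
  from this[of "Poly_Mapping.keys x"] show ?thesis
    using free_alg_expand[of x] by simp
qed

lemma free_alg_induct [case_names zero add mono]:
  assumes "P 0" and "\<And>x y. P x \<Longrightarrow> P y \<Longrightarrow> P (x + y)" and "\<And>c w. P (scal c (monomial w))"
  shows "P x"
proof -
  have "P (\<Sum>w\<in>A. scal (Poly_Mapping.lookup x w) (monomial (letters w)))" if "finite A" for A
    using that by (induct A) (use assms in auto)
  from this[of "Poly_Mapping.keys x"] show ?thesis
    using free_alg_expand[of x] by simp
qed

text \<open>Scalar multiplication is multiplication by an element supported on the empty word, and
  such elements are central.\<close>

lemma scal_mult_left [simp]: "scal c x * y = scal c (x * y)"
  and scal_mult_right [simp]: "x * scal c y = scal c (x * y)"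
proof -
  have s: "scal c z = Poly_Mapping.single 0 c * z" for c and z :: "'a free_alg"
    by (simp add: scal_def mult_map_scale_conv_mult)
  have comm: "Poly_Mapping.single 0 c * z = z * Poly_Mapping.single 0 c" for z :: "'a free_alg"
  proof (induct z rule: free_alg_induct)
    case (mono d w)
    then show ?case
      unfolding s monomial_def by (simp add: mult_single mult.commute)
  qed (simp_all add: distrib_left distrib_right)
  show "scal c x * y = scal c (x * y)" by (simp add: s mult.assoc)
  show "x * scal c y = scal c (x * y)"
    using comm[of x] by (metis s mult.assoc)
qed

lemma scal_simps [simp]:
  "scal c (x + y) = scal c x + scal c y" "scal c (x - y) = scal c x - scal c y"
  "scal c (- x) = - scal c x"
  "scal c 0 = 0" "scal 0 x = 0" "scal 1 x = x" "scal c (scal d x) = scal (c * d) x"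
  by (rule free_alg.scale_right_distrib free_alg.scale_right_diff_distrib
      free_alg.scale_minus_right free_alg.scale_zero_right free_alg.scale_zero_left
      free_alg.scale_one free_alg.scale_scale)+

lemma scal_sum: "scal c (\<Sum>k\<in>A. f k) = (\<Sum>k\<in>A. scal c (f k))"
  by (rule free_alg.scale_sum_right)

lemma monomial_mult [simp]: "monomial u * monomial v = monomial (u @ v)"
  by (simp add: monomial_def mult_single plus_free_monoid_def)

lemma monomial_Nil [simp]: "monomial [] = 1"
  by (metis monomial_def single_one zero_free_monoid_def)

text \<open>The keys of a sum or a multiple depend on cancellation; summing over a common finite
  superset makes linearity a termwise computation.\<close>

lemma lin_ext_superset:
  assumes "finite A" "Poly_Mapping.keys x \<subseteq> A"
  shows "lin_ext f x = (\<Sum>w\<in>A. scal (Poly_Mapping.lookup x w) (f (letters w)))"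
  unfolding lin_ext_def using assms
  by (intro sum.mono_neutral_left) (auto simp: in_keys_iff)

lemma lin_ext_add [simp]: "lin_ext f (x + y) = lin_ext f x + lin_ext f y"
proof -
  let ?A = "Poly_Mapping.keys x \<union> Poly_Mapping.keys y"
  have "Poly_Mapping.keys (x + y) \<subseteq> ?A" by (rule keys_add)
  then show ?thesis
    by (simp add: lin_ext_superset[of ?A] lookup_add free_alg.scale_left_distrib sum.distrib)
qed

lemma lin_ext_scal [simp]: "lin_ext f (scal c x) = scal c (lin_ext f x)"
proof -
  have "Poly_Mapping.keys (scal c x) \<subseteq> Poly_Mapping.keys x"
    by (auto simp: in_keys_iff lookup_scal)
  then show ?thesis
    by (simp add: lin_ext_superset[of "Poly_Mapping.keys x"] lookup_scal scal_sum)
qed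

lemma lin_ext_monomial [simp]: "lin_ext f (monomial w) = f w"
  by (simp add: lin_ext_def monomial_def)

lemma lin_ext_zero [simp]: "lin_ext f 0 = 0"
  by (simp add: lin_ext_def)

lemma lin_ext_one [simp]: "lin_ext f 1 = f []"
  using lin_ext_monomial[of f "[]"] by simp

lemma lin_ext_uminus [simp]: "lin_ext f (- x) = - lin_ext f x"
  using lin_ext_add[of f x "- x"] by (simp add: add_eq_0_iff2 del: lin_ext_add)

lemma lin_ext_diff [simp]: "lin_ext f (x - y) = lin_ext f x - lin_ext f y"
  using lin_ext_add[of f x "- y"] by (simp del: lin_ext_add)

lemma lin_ext_sum: "lin_ext f (\<Sum>k\<in>A. g k) = (\<Sum>k\<in>A. lin_ext f (g k))"
  by (induct A rule: infinite_finite_induct) auto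

lemma lin_ext_mult:
  assumes "\<And>u v. f (u @ v) = f u * f v"
  shows "lin_ext f (x * y) = lin_ext f x * lin_ext f y"
proof (induct x rule: free_alg_induct)
  case (mono c u)
  have "lin_ext f (monomial u * y) = f u * lin_ext f y"
    by (induct y rule: free_alg_induct) (simp_all add: assms algebra_simps)
  then show ?case by simp
qed (simp_all add: algebra_simps)

lemma subspace_tensor_power: "free_alg.subspace (tensor_power n)"
  unfolding free_alg.subspace_def
proof (intro conjI ballI allI)
  fix x y :: tensor assume "x \<in> tensor_power n" "y \<in> tensor_power n"
  then show "x + y \<in> tensor_power n"
    using keys_add[of x y] by (auto simp: tensor_power_def)
qed (auto simp: tensor_power_def in_keys_iff lookup_scal)

lemmas tensor_power_closed =
  free_alg.subspace_0[OF subspace_tensor_power] free_alg.subspace_add[OF subspace_tensor_power]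
  free_alg.subspace_diff[OF subspace_tensor_power] free_alg.subspace_scale[OF subspace_tensor_power]
  free_alg.subspace_sum[OF subspace_tensor_power]

lemma monomial_in_tensor_power [simp]: "monomial w \<in> tensor_power n \<longleftrightarrow> length w = n"
  by (simp add: tensor_power_def monomial_def)

lemma lin_ext_in_tensor_power:
  assumes "x \<in> tensor_power n" and "\<And>w. length w = n \<Longrightarrow> f w \<in> tensor_power k"
  shows "lin_ext f x \<in> tensor_power k"
  using assms(1) by (induct x rule: tensor_power_induct) (auto intro: tensor_power_closed assms(2))

lemma mult_in_tensor_power:
  assumes "x \<in> tensor_power m" and "y \<in> tensor_power n"
  shows "x * y \<in> tensor_power (m + n)"
  using assms(1)
proof (induct x rule: tensor_power_induct)
  case (mono c u)
  from assms(2) have "monomial u * y \<in> tensor_power (m + n)"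
    by (induct y rule: tensor_power_induct)
      (use mono in \<open>auto simp: algebra_simps intro: tensor_power_closed\<close>)
  then show ?case by (simp add: tensor_power_closed)
qed (simp_all add: algebra_simps tensor_power_closed)

section \<open>Weighted cyclic shifts\<close>

text \<open>
  On words of length \<open>n\<close> the \<open>n\<close>-th power of a weighted shift is diagonal, its entries being the
  products of the weights over the rotation orbits. If these differ from 1, then \<open>1 - S\<close> is bijective,
  since \<open>1 - S\<^sup>n = (1 - S) (1 + S + \<cdots> + S\<^sup>n\<^sup>-\<^sup>1)\<close>.
\<close>

definition rot :: "'a list \<Rightarrow> 'a list" where
  "rot w = rev (rotate1 (rev w))"

lemma rot_snoc [simp]: "rot (v @ [j]) = j # v"
  by (simp add: rot_def)

text \<open>Conjugation by \<open>rev\<close> turns the move of the last letter to the front into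
  \<open>rotate\<close>, whose iteration laws can then be used.\<close>

lemma rot_pow: "(rot ^^ k) w = rev (rotate k (rev w))"
  by (induct k) (simp_all add: rot_def rotate_def)

lemma length_rot_pow [simp]: "length ((rot ^^ k) w) = length w"
  by (simp add: rot_pow)

lemma rot_pow_length: "(rot ^^ length w) w = w"
  using rotate_id[of "length (rev w)" "rev w"] by (simp add: rot_pow)

lemma rot_pow_append: "(rot ^^ length v) (u @ v) = v @ u"
  using rotate_append[of "rev v" "rev u"] by (simp add: rot_pow)

definition shift :: "(index list \<Rightarrow> complex) \<Rightarrow> tensor \<Rightarrow> tensor" where
  "shift f = lin_ext (\<lambda>w. scal (f w) (monomial (rot w)))"

definition orbit_weight :: "(index list \<Rightarrow> complex) \<Rightarrow> index list \<Rightarrow> complex" where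
  "orbit_weight f w = (\<Prod>t<length w. f ((rot ^^ t) w))"

text \<open>This forces every orbit product to have modulus below 1. Nonempty \<open>u\<close>
  places the strict factor at step \<open>length v < length w\<close>, inside the range of the
  product.\<close>

definition contracting :: "(index list \<Rightarrow> complex) \<Rightarrow> nat \<Rightarrow> bool" where
  "contracting f n \<longleftrightarrow> (\<forall>w. length w = n \<longrightarrow> cmod (f w) \<le> 1) \<and>
     (\<forall>w. length w = n \<longrightarrow> (\<exists>u v. w = u @ v \<and> u \<noteq> [] \<and> cmod (f (v @ u)) < 1))"

lemma orbit_weight_neq_1:
  assumes "contracting f n" and "length w = n"
  shows "orbit_weight f w \<noteq> 1"
proof -
  obtain u v where w: "w = u @ v" and u: "u \<noteq> []" and lt: "cmod (f (v @ u)) < 1"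
    using assms unfolding contracting_def by metis
  have v: "length v < length w" and fv: "(rot ^^ length v) w = v @ u"
    using u by (simp_all add: w rot_pow_append)
  have le: "cmod (f ((rot ^^ t) w)) \<le> 1" for t
    using assms by (simp add: contracting_def)
  \<comment> \<open>Isolate the factor at step \<open>length v\<close>, where the rotated word is
    \<open>v @ u\<close>; all others are at most 1.\<close>
  have "cmod (orbit_weight f w)
      = cmod (f (v @ u)) * (\<Prod>t\<in>{..<length w} - {length v}. cmod (f ((rot ^^ t) w)))"
    using v fv by (simp add: orbit_weight_def norm_mult prod_norm prod.remove[of _ "length v"])
  also have "\<dots> \<le> cmod (f (v @ u)) * 1"
    by (intro mult_left_mono prod_le_1) (auto simp: le)
  finally show ?thesis using lt by auto
qed

lemma shift_simps [simp]:
  "shift f 0 = 0" "shift f (x + y) = shift f x + shift f y"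
  "shift f (scal c x) = scal c (shift f x)" "shift f (monomial w) = scal (f w) (monomial (rot w))"
  by (simp_all add: shift_def)

lemma shift_pow_monomial:
  "(shift f ^^ k) (monomial w) = scal (\<Prod>t<k. f ((rot ^^ t) w)) (monomial ((rot ^^ k) w))"
proof (induct k)
  case (Suc k)
  then show ?case
    by (simp add: mult.commute)
qed simp

lemma shift_pow_add: "(shift f ^^ k) (x + y) = (shift f ^^ k) x + (shift f ^^ k) y"
  and shift_pow_scal: "(shift f ^^ k) (scal c x) = scal c ((shift f ^^ k) x)"
  and shift_pow_zero: "(shift f ^^ k) 0 = 0"
  by (induct k) (simp_all add: shift_def)

lemma shift_pow_length:
  assumes "x \<in> tensor_power n"
  shows "(shift f ^^ n) x = lin_ext (\<lambda>w. scal (orbit_weight f w) (monomial w)) x"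
  using assms
proof (induct x rule: tensor_power_induct)
  case (mono c w)
  then have "(rot ^^ n) w = w" using rot_pow_length by metis
  with mono show ?case
    by (simp add: shift_pow_scal shift_pow_monomial orbit_weight_def)
qed (simp_all add: shift_pow_add shift_pow_zero)

lemma lin_ext_diag_inverse:
  assumes "x \<in> tensor_power n" and "\<And>w. length w = n \<Longrightarrow> g w * f w = 1"
  shows "lin_ext (\<lambda>w. scal (g w) (monomial w)) (lin_ext (\<lambda>w. scal (f w) (monomial w)) x) = x"
  using assms(1)
  by (induct x rule: tensor_power_induct) (simp_all add: assms(2) mult.assoc mult.commute[of "f _" "g _"])

lemma shift_fixed_imp_zero:
  assumes "contracting f n" and x: "x \<in> tensor_power n" and fixed: "shift f x = x"
  shows "x = 0"
proof -
  have "(shift f ^^ k) x = x" for k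
    by (induct k) (simp_all add: fixed)
  \<comment> \<open>A fixed \<open>x\<close> equals its image under the \<open>n\<close>-th power of
    the shift, which is diagonal.\<close>
  then have "x - lin_ext (\<lambda>w. scal (orbit_weight f w) (monomial w)) x = 0"
    by (simp flip: shift_pow_length[OF x])
  moreover have "x - lin_ext (\<lambda>w. scal (orbit_weight f w) (monomial w)) x
      = lin_ext (\<lambda>w. scal (1 - orbit_weight f w) (monomial w)) x" 
    by (induct x rule: free_alg_induct) (simp_all add: algebra_simps free_alg.scale_left_diff_distrib)
  ultimately have "lin_ext (\<lambda>w. scal (1 - orbit_weight f w) (monomial w)) x = 0"
    by simp
  moreover have "lin_ext (\<lambda>w. scal (1 / (1 - orbit_weight f w)) (monomial w))
       (lin_ext (\<lambda>w. scal (1 - orbit_weight f w) (monomial w)) x) = x"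
    using orbit_weight_neq_1[OF assms(1)] by (intro lin_ext_diag_inverse[OF x]) auto
  ultimately show ?thesis by simp
qed

lemma shift_in_tensor_power: "x \<in> tensor_power n \<Longrightarrow> shift f x \<in> tensor_power n"
  unfolding shift_def
  by (rule lin_ext_in_tensor_power) (auto intro: tensor_power_closed simp: rot_def)

lemma diff_shift_surj:
  assumes "contracting f n" and x: "x \<in> tensor_power n"
  obtains y where "y \<in> tensor_power n" "x = y - shift f y"
proof -
  \<comment> \<open>\<open>z\<close> inverts the diagonal operator \<open>1 - S^n\<close>; the
    geometric sum \<open>y\<close> then satisfies \<open>y - S y = z - S^n z = x\<close>.\<close>
  define z where "z = lin_ext (\<lambda>w. scal (1 / (1 - orbit_weight f w)) (monomial w)) x"
  have z: "z \<in> tensor_power n"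
    unfolding z_def by (rule lin_ext_in_tensor_power[OF x]) (simp add: tensor_power_closed)
  have zk: "(shift f ^^ k) z \<in> tensor_power n" for k
    by (induct k) (simp_all add: z shift_in_tensor_power)
  define y where "y = (\<Sum>k<n. (shift f ^^ k) z)"
  have "shift f y = (\<Sum>k<n. (shift f ^^ Suc k) z)"
    by (simp add: y_def shift_def lin_ext_sum)
  then have "y - shift f y = z - (shift f ^^ n) z"
    unfolding y_def using sum_lessThan_telescope'[of "\<lambda>k. (shift f ^^ k) z" n]
    by (simp add: sum_subtractf del: funpow.simps)
  also have "\<dots> = lin_ext (\<lambda>w. scal (1 - orbit_weight f w) (monomial w)) z"
    unfolding shift_pow_length[OF z]
    by (induct z rule: free_alg_induct) (simp_all add: algebra_simps free_alg.scale_left_diff_distrib)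
  also have "\<dots> = x"
    unfolding z_def using orbit_weight_neq_1[OF assms(1)] by (intro lin_ext_diag_inverse[OF x]) auto
  finally show ?thesis
    using that[of y] zk by (simp add: y_def tensor_power_closed)
qed

lemma card_index: "card (UNIV :: index set) = 2" and finite_index: "finite (UNIV :: index set)"
proof -
  have "(UNIV :: index set) = {I1, I2}" by (auto intro: index.exhaust)
  then show "card (UNIV :: index set) = 2" "finite (UNIV :: index set)"
    by (metis card_2_iff index.distinct(1), metis finite.emptyI finite.insertI)
qed

section \<open>Splitting off an outer letter\<close>

definition strip_left :: "index \<Rightarrow> tensor \<Rightarrow> tensor" where
  "strip_left i = lin_ext (\<lambda>w. if w \<noteq> [] \<and> hd w = i then monomial (tl w) else 0)"

definition strip_right :: "index \<Rightarrow> tensor \<Rightarrow> tensor" where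
  "strip_right i = lin_ext (\<lambda>w. if w \<noteq> [] \<and> last w = i then monomial (butlast w) else 0)"

lemma strip_simps [simp]:
  "strip_left i 0 = 0" "strip_left i (x + y) = strip_left i x + strip_left i y"
  "strip_right i 0 = 0" "strip_right i (x + y) = strip_right i x + strip_right i y"
  by (simp_all add: strip_left_def strip_right_def)

lemma strip_left_mult: "strip_left i (monomial [j] * x) = (if i = j then x else 0)"
  unfolding strip_left_def by (induct x rule: free_alg_induct) (auto simp: algebra_simps)

lemma strip_right_mult: "strip_right i (x * monomial [j]) = (if i = j then x else 0)"
  unfolding strip_right_def by (induct x rule: free_alg_induct) (auto simp: algebra_simps)

lemma strip_right_in_tensor_power: "x \<in> tensor_power (Suc n) \<Longrightarrow> strip_right i x \<in> tensor_power n"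
  unfolding strip_right_def by (rule lin_ext_in_tensor_power) (auto simp: tensor_power_closed)

lemma strip_right_expand:
  assumes "x \<in> tensor_power (Suc n)"
  shows "x = strip_right I1 x * monomial [I1] + strip_right I2 x * monomial [I2]"
  using assms
proof (induct x rule: tensor_power_induct)
  case (mono c w)
  then have w: "w = butlast w @ [last w]" "w \<noteq> []"
    by (metis append_butlast_last_id list.size(3) nat.distinct(1))+
  have "monomial w = strip_right I1 (monomial w) * monomial [I1] + strip_right I2 (monomial w) * monomial [I2]"
    unfolding strip_right_def by (cases "last w") (use w in auto)
  then show ?case by (simp add: strip_right_def flip: scal_simps(1))
qed (simp_all add: strip_right_def algebra_simps)

lemma left_generators_eq_0:
  assumes "monomial [I1] * x + monomial [I2] * y = (0 :: tensor)"
  shows "x = 0" "y = 0"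
  using arg_cong[OF assms, of "strip_left I1"] arg_cong[OF assms, of "strip_left I2"]
  by (simp_all add: strip_left_mult)

lemma right_generators_eq_0:
  assumes "x * monomial [I1] + y * monomial [I2] = (0 :: tensor)"
  shows "x = 0" "y = 0"
  using arg_cong[OF assms, of "strip_right I1"] arg_cong[OF assms, of "strip_right I2"]
  by (simp_all add: strip_right_mult)

lemma mult_degree_one_mem_tensor_prod:
  assumes "x \<in> U" "y \<in> U"
  shows "x * monomial [I1] + y * monomial [I2] \<in> tensor_prod U (tensor_power 1)"
  unfolding tensor_prod_def
  by (intro free_alg.span_add free_alg.span_base) (use assms in force)+

section \<open>Skew derivations of the tensor algebra\<close>

locale wick_params =
  fixes q :: real and l :: complex
  assumes q_pos: "0 < q" and q_less_1: "q < 1" and cmod_l: "cmod l = 1"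
begin

text \<open>Two roles coincide: \<open>T\<close> sends \<open>e_j e_i\<close> to
  \<open>coef i j\<close> times \<open>e_i e_j\<close>, and \<open>coef i j\<close> is the
  coefficient of \<open>a_j a_i^*\<close> in the relation for \<open>a_i^* a_j\<close>.\<close>

definition coef :: "index \<Rightarrow> index \<Rightarrow> complex" where
  "coef i j = (if i = j then of_real q else if i = I1 then l else cnj l)"

definition weight :: "index \<Rightarrow> index list \<Rightarrow> complex" where
  "weight i w = prod_list (map (coef i) w)"

definition twist :: "index \<Rightarrow> tensor \<Rightarrow> tensor" where
  "twist i = lin_ext (\<lambda>w. scal (weight i w) (monomial w))"

text \<open>The recursion is the twisted Leibniz rule for splitting off the first letter.\<close>

primrec deriv_word :: "index \<Rightarrow> index list \<Rightarrow> tensor" where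
  "deriv_word i [] = 0"
| "deriv_word i (j # w) =
     (if i = j then monomial w else 0) + scal (coef i j) (monomial [j] * deriv_word i w)"

definition deriv :: "index \<Rightarrow> tensor \<Rightarrow> tensor" where
  "deriv i = lin_ext (deriv_word i)"

lemma weight_simps [simp]:
  "weight i [] = 1" "weight i (j # w) = coef i j * weight i w"
  "weight i (u @ v) = weight i u * weight i v"
  by (simp_all add: weight_def)

lemma twist_simps [simp]:
  "twist i 0 = 0" "twist i 1 = 1" "twist i (x + y) = twist i x + twist i y"
  "twist i (x - y) = twist i x - twist i y"
  "twist i (scal c x) = scal c (twist i x)" "twist i (monomial w) = scal (weight i w) (monomial w)"
  by (simp_all add: twist_def)

lemma twist_mult [simp]: "twist i (x * y) = twist i x * twist i y"
  unfolding twist_def by (rule lin_ext_mult) (simp add: mult.commute)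

lemma deriv_simps [simp]:
  "deriv i 0 = 0" "deriv i 1 = 0" "deriv i (x + y) = deriv i x + deriv i y"
  "deriv i (x - y) = deriv i x - deriv i y" "deriv i (scal c x) = scal c (deriv i x)"
  "deriv i (monomial w) = deriv_word i w"
  by (simp_all add: deriv_def)

lemma deriv_generator_mult:
  "deriv i (monomial [j] * x) = (if i = j then x else 0) + scal (coef i j) (monomial [j] * deriv i x)"
  by (induct x rule: free_alg_induct) (simp_all add: algebra_simps mult.commute)

lemma deriv_mult: "deriv i (x * y) = deriv i x * y + twist i x * deriv i y"
proof (induct x rule: free_alg_induct)
  case (mono c u)
  have "deriv i (monomial u * y) = deriv_word i u * y + scal (weight i u) (monomial u * deriv i y)"
  proof (induct u)
    case (Cons j u)
    have "deriv i (monomial (j # u) * y) = deriv i (monomial [j] * (monomial u * y))"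
      by (simp flip: mult.assoc)
    also have "\<dots> = (if i = j then monomial u * y else 0)
        + scal (coef i j) (monomial [j] * deriv i (monomial u * y))"
      by (rule deriv_generator_mult)
    finally show ?case
      by (simp add: Cons algebra_simps flip: mult.assoc)
  qed simp
  then show ?case by simp
qed (simp_all add: algebra_simps)

text \<open>Each term of the derivative loses exactly one letter \<open>i\<close>, hence the factor
  \<open>coef j i\<close> of the weight. Multiplying that factor back in avoids division.\<close>

lemma weight_deriv:
  "scal (coef j i) (twist j (deriv i (monomial w))) = scal (weight j w) (deriv i (monomial w))"
proof (induct w)
  case (Cons k w)
  have "scal (coef j i * d) (monomial [k] * twist j (deriv_word i w))
      = scal (d * weight j w) (monomial [k] * deriv_word i w)" for d
    using arg_cong[OF Cons, of "\<lambda>x. scal d (monomial [k] * x)"] by (simp add: mult.commute)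
  from this[of "coef i k * coef j k"] show ?case by (simp add: ac_simps)
qed simp

lemma deriv_twist: "deriv i (twist j x) = scal (coef j i) (twist j (deriv i x))"
proof (induct x rule: free_alg_induct)
  case (mono c w)
  show ?case using arg_cong[OF weight_deriv[of j i w], of "scal c"]
    by (simp add: mult.commute)
qed (simp_all add: algebra_simps)

lemma deriv_in_tensor_power:
  assumes "x \<in> tensor_power (Suc n)"
  shows "deriv i x \<in> tensor_power n"
proof -
  have "length w = Suc n \<Longrightarrow> deriv_word i w \<in> tensor_power n" for w n
  proof (induct w arbitrary: n)
    case (Cons j w)
    \<comment> \<open>When \<open>n = 0\<close> the remaining word is empty and its derivative is 0,
      which lies in every tensor power.\<close>
    have "monomial [j] * deriv_word i w \<in> tensor_power n"
    proof (cases n)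
      case (Suc k)
      then have "deriv_word i w \<in> tensor_power k"
        using Cons.hyps[of k] Cons.prems by simp
      then have "monomial [j] * deriv_word i w \<in> tensor_power (1 + k)"
        by (intro mult_in_tensor_power) simp_all
      then show ?thesis by (simp add: Suc)
    qed (use Cons.prems in \<open>simp add: tensor_power_closed\<close>)
    with Cons.prems show ?case by (auto intro!: tensor_power_closed)
  qed simp
  with assms show ?thesis unfolding deriv_def by (rule lin_ext_in_tensor_power)
qed

lemma twist_in_tensor_power: "x \<in> tensor_power n \<Longrightarrow> twist i x \<in> tensor_power n"
  unfolding twist_def by (rule lin_ext_in_tensor_power) (auto intro: tensor_power_closed)

section \<open>The kernels of \<open>R\<^sub>n\<close>\<close>

lemma T_basis_eq: "T_basis q l i j = scal (coef j i) (monomial [j, i])"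
  by (cases i; cases j) (simp_all add: coef_def)

lemma T_prod_simps [simp]:
  "T_prod q l k (x + y) = T_prod q l k x + T_prod q l k y"
  "T_prod q l k (scal c x) = scal c (T_prod q l k x)" "T_prod q l k 0 = 0"
  by (induct k arbitrary: x y) (simp_all add: T_at_def)

text \<open>The letter at position \<open>k\<close>, counted from 0, travels to the front; crossing
  each earlier letter contributes one factor \<open>coef\<close>.\<close>

lemma T_prod_monomial:
  "k < length w \<Longrightarrow> T_prod q l k (monomial w)
     = scal (weight (w ! k) (take k w)) (monomial (w ! k # take k w @ drop (Suc k) w))"
proof (induct k arbitrary: w)
  case 0
  then show ?case by (simp add: Cons_nth_drop_Suc[of 0 w, simplified])
next
  case (Suc k)
  \<comment> \<open>The last factor of the product acts first and swaps positions \<open>k\<close>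
    and \<open>k + 1\<close>; the induction hypothesis carries the swapped letter the rest of the
    way.\<close>
  let ?w = "take k w @ w ! Suc k # w ! k # drop (Suc (Suc k)) w"
  have [simp]: "?w ! k = w ! Suc k" "take k ?w = take k w" "drop (Suc k) ?w = w ! k # drop (Suc (Suc k)) w"
    using Suc.prems by (simp_all add: nth_append)
  have "T_prod q l (Suc k) (monomial w) = scal (coef (w ! Suc k) (w ! k)) (T_prod q l k (monomial ?w))"
    by (simp add: T_at_def T_basis_eq)
  also have "T_prod q l k (monomial ?w) = scal (weight (w ! Suc k) (take k w))
      (monomial (w ! Suc k # take k w @ w ! k # drop (Suc (Suc k)) w))"
    by (subst Suc.hyps) (use Suc.prems in simp_all)
  finally show ?case
    using Suc.prems by (simp add: take_Suc_conv_app_nth mult.commute)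
qed

text \<open>Unfolding the recursion gives one term per occurrence of \<open>i\<close>, weighted by
  the letters before it. In this form it can be matched with \<open>T_prod_monomial\<close>.\<close>

lemma deriv_word_eq:
  "deriv_word i w = (\<Sum>k<length w. if w ! k = i
     then scal (weight i (take k w)) (monomial (take k w @ drop (Suc k) w)) else 0)"
proof (induct w)
  case (Cons j w)
  have *: "monomial [j] * (if P then scal c (monomial v) else 0)
      = (if P then scal c (monomial (j # v)) else 0)" for P c v
    by simp
  have "scal d (if P then scal c (monomial v) else 0)
      = (if P then scal (d * c) (monomial v) else 0)" for P c d and v :: "index list"
    by simp
  moreover have "weight i (take (Suc k) (j # w)) = coef i j * weight i (take k w)" for k
    by simp
  ultimately show ?case
    by (simp add: Cons sum.lessThan_Suc_shift sum_distrib_left scal_sum * del: sum.lessThan_Suc cong: if_cong)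
qed simp

lemma R_op_simps [simp]:
  "R_op q l n (x + y) = R_op q l n x + R_op q l n y"
  "R_op q l n (scal c x) = scal c (R_op q l n x)" "R_op q l n 0 = 0"
  by (simp_all add: R_op_def sum.distrib scal_sum)

lemma R_op_eq:
  assumes "x \<in> tensor_power n"
  shows "R_op q l n x = monomial [I1] * deriv I1 x + monomial [I2] * deriv I2 x"
  using assms
proof (induct x rule: tensor_power_induct)
  case (mono c w)
  have "monomial [I1] * deriv_word I1 w + monomial [I2] * deriv_word I2 w = R_op q l n (monomial w)"
    unfolding deriv_word_eq sum_distrib_left sum.distrib[symmetric] R_op_def mono
  proof (intro sum.cong refl)
    \<comment> \<open>At each position only the derivation belonging to the letter there
      contributes, and its term is the word produced by \<open>T_prod q l k\<close>.\<close>
    fix k assume "k \<in> {..<n}"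
    then show "monomial [I1] * (if w ! k = I1 then scal (weight I1 (take k w))
             (monomial (take k w @ drop (Suc k) w)) else 0)
         + monomial [I2] * (if w ! k = I2 then scal (weight I2 (take k w))
             (monomial (take k w @ drop (Suc k) w)) else 0) = T_prod q l k (monomial w)"
      by (cases "w ! k") (simp_all add: T_prod_monomial mono)
  qed
  then show ?case by (simp flip: scal_simps(1))
qed (simp_all add: algebra_simps)

text \<open>The two summands of \<open>R_op_eq\<close> begin with different letters, so they vanish
  separately.\<close>

lemma mem_ker_R_iff: "x \<in> ker_R q l n \<longleftrightarrow> x \<in> tensor_power n \<and> (\<forall>i. deriv i x = 0)"
proof -
  have all: "(\<forall>i. deriv i x = 0) \<longleftrightarrow> deriv I1 x = 0 \<and> deriv I2 x = 0"
    using index.exhaust by metis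
  have "monomial [I1] * deriv I1 x + monomial [I2] * deriv I2 x = 0
      \<longleftrightarrow> deriv I1 x = 0 \<and> deriv I2 x = 0"
    using left_generators_eq_0 by (metis add_0 mult_zero_right)
  then show ?thesis
    unfolding all ker_R_def by (simp add: R_op_eq cong: conj_cong)
qed

lemma subspace_ker_R: "free_alg.subspace (ker_R q l n)"
  unfolding free_alg.subspace_def by (auto simp: mem_ker_R_iff tensor_power_closed)

lemma twist_ker_R: "x \<in> ker_R q l n \<Longrightarrow> twist i x \<in> ker_R q l n"
  by (auto simp: mem_ker_R_iff deriv_twist twist_in_tensor_power)

section \<open>Contraction estimates for the weights\<close>

lemma cmod_coef_le: "cmod (coef i j) \<le> 1"
  and cmod_coef_same: "cmod (coef i i) < 1"
  using q_pos q_less_1 cmod_l by (auto simp: coef_def)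

lemma cmod_weight_le: "cmod (weight i w) \<le> 1"
  by (induct w) (auto simp: norm_mult intro!: mult_le_one cmod_coef_le)

lemma cmod_weight_less:
  assumes "i \<in> set w"
  shows "cmod (weight i w) < 1"
proof -
  obtain u v where w: "w = u @ i # v" using assms by (meson split_list)
  have "cmod (weight i w) = cmod (coef i i) * (cmod (weight i u) * cmod (weight i v))"
    by (simp add: w norm_mult)
  also have "\<dots> \<le> cmod (coef i i) * 1"
    by (intro mult_left_mono mult_le_one cmod_weight_le) auto
  also have "\<dots> < 1" by (simp add: cmod_coef_same)
  finally show ?thesis .
qed

text \<open>The factor collected when the last letter is carried to the front past all the
  others.\<close>

definition tail_weight :: "index list \<Rightarrow> complex" where
  "tail_weight w = weight (last w) (butlast w)"

text \<open>The extra factor arises when \<open>D\<^sub>i\<close> is moved past the shift.\<close>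

definition deriv_tail_weight :: "index \<Rightarrow> index list \<Rightarrow> complex" where
  "deriv_tail_weight i w = coef i (last w) * coef (last w) i * tail_weight w"

lemma cmod_tail_weight_le: "cmod (tail_weight w) \<le> 1"
  by (simp add: tail_weight_def cmod_weight_le)

lemma not_distinct_rot_tail_weight:
  assumes "\<not> distinct w"
  obtains u v where "w = u @ v" "u \<noteq> []" "cmod (tail_weight (v @ u)) < 1"
proof -
  obtain xs ys zs y where w: "w = xs @ [y] @ ys @ [y] @ zs"
    using not_distinct_decomp[OF assms] by blast
  show ?thesis
  proof (rule that)
    \<comment> \<open>Cutting just after the first of two equal letters \<open>y\<close> rotates it
      to the end, with the second copy ahead of it; carrying \<open>y\<close> past its copy costs a
      factor \<open>q < 1\<close>.\<close>
    show "w = (xs @ [y]) @ (ys @ [y] @ zs)" by (simp add: w)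
    show "cmod (tail_weight ((ys @ [y] @ zs) @ (xs @ [y]))) < 1"
      by (auto simp add: tail_weight_def butlast_append intro!: cmod_weight_less simp del: weight_simps)
  qed simp
qed

lemma contracting_tail_weight:
  assumes "n \<ge> 3"
  shows "contracting tail_weight n"
  unfolding contracting_def
proof (intro conjI allI impI cmod_tail_weight_le)
  fix w :: "index list" assume "length w = n"
  \<comment> \<open>Pigeonhole: at least three letters from an alphabet of two.\<close>
  then have "\<not> distinct w"
    using assms card_mono[OF finite_index, of "set w"] card_index by (auto simp: distinct_card)
  then show "\<exists>u v. w = u @ v \<and> u \<noteq> [] \<and> cmod (tail_weight (v @ u)) < 1"
    by (rule not_distinct_rot_tail_weight) blast
qed

text \<open>A word with a repeated letter is handled by \<open>tail_weight\<close>. The bound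
  \<open>n >= 2\<close> also admits words with distinct letters; these use both letters, and
  rotating \<open>i\<close> to the end makes the extra factor contain
  \<open>coef i i\<close>.\<close>

lemma contracting_deriv_tail_weight:
  assumes "n \<ge> 2"
  shows "contracting (deriv_tail_weight i) n"
  unfolding contracting_def
proof (intro conjI allI impI)
  have le: "cmod (deriv_tail_weight i w) \<le> cmod (coef i (last w))"
           "cmod (deriv_tail_weight i w) \<le> cmod (tail_weight w)" for w
  proof -
    have "cmod (coef (last w) i) * cmod (tail_weight w) \<le> 1"
      "cmod (coef i (last w)) * cmod (coef (last w) i) \<le> 1"
      by (intro mult_le_one cmod_coef_le cmod_tail_weight_le norm_ge_zero)+
    then show "cmod (deriv_tail_weight i w) \<le> cmod (coef i (last w))"
      "cmod (deriv_tail_weight i w) \<le> cmod (tail_weight w)"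
      using mult_left_mono[of "cmod (coef (last w) i) * cmod (tail_weight w)" 1 "cmod (coef i (last w))"]
        mult_right_mono[of "cmod (coef i (last w)) * cmod (coef (last w) i)" 1 "cmod (tail_weight w)"]
      by (simp_all add: deriv_tail_weight_def norm_mult mult.assoc)
  qed
  fix w :: "index list" assume len: "length w = n"
  show "cmod (deriv_tail_weight i w) \<le> 1"
    using le(1) cmod_coef_le by (rule order_trans)
  show "\<exists>u v. w = u @ v \<and> u \<noteq> [] \<and> cmod (deriv_tail_weight i (v @ u)) < 1"
  proof (cases "distinct w")
    case True
    have "set w = UNIV"
    proof (rule card_subset_eq[OF finite_index])
      show "card (set w) = card (UNIV :: index set)"
        using True len assms card_mono[OF finite_index, of "set w"] by (simp add: distinct_card card_index)
    qed simp
    then have "i \<in> set w" by simp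
    then obtain xs ys where w: "w = (xs @ [i]) @ ys"
      by (metis append.assoc append_Cons append_Nil split_list)
    have "cmod (deriv_tail_weight i (ys @ xs @ [i])) \<le> cmod (coef i i)"
      using le(1)[of "ys @ xs @ [i]"] by simp
    then show ?thesis using cmod_coef_same[of i] w
      by (intro exI[of _ "xs @ [i]"] exI[of _ ys]) auto
  next
    case False
    then show ?thesis
      by (rule not_distinct_rot_tail_weight) (metis le(2) le_less_trans)
  qed
qed

lemma T_prod_eq_shift:
  assumes "x \<in> tensor_power (Suc n)"
  shows "T_prod q l n x = shift tail_weight x"
  using assms
proof (induct x rule: tensor_power_induct)
  case (mono c w)
  then obtain v j where "w = v @ [j]" by (metis length_Suc_conv_rev)
  with mono show ?case by (auto simp: T_prod_monomial tail_weight_def nth_append)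
qed simp_all

lemma shift_tail_weight: "shift tail_weight (x * monomial [j]) = monomial [j] * twist j x"
  by (induct x rule: free_alg_induct) (simp_all add: algebra_simps tail_weight_def)

lemma shift_deriv_tail_weight:
  "shift (deriv_tail_weight i) (x * monomial [j])
     = scal (coef i j * coef j i) (monomial [j] * twist j x)"
  by (induct x rule: free_alg_induct) (simp_all add: algebra_simps tail_weight_def deriv_tail_weight_def)

text \<open>Both products contribute \<open>twist i x\<close> when \<open>i = j\<close>, and these
  terms cancel. What remains carries the two crossing coefficients \<open>coef i j\<close> and
  \<open>coef j i\<close>, hence the shift with the enlarged weight.\<close>

lemma deriv_commutator:
  "deriv i (x * monomial [j] - monomial [j] * twist j x)
     = deriv i x * monomial [j] - shift (deriv_tail_weight i) (deriv i x * monomial [j])"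
proof -
  have "deriv i (x * monomial [j]) = deriv i x * monomial [j] + (if i = j then twist i x else 0)"
    by (simp add: deriv_mult)
  then show ?thesis
    by (simp add: shift_deriv_tail_weight deriv_generator_mult deriv_twist)
qed

lemma generator_commutator_mem_ker_R:
  assumes "x \<in> ker_R q l n"
  shows "x * monomial [j] - monomial [j] * twist j x \<in> ker_R q l (Suc n)"
proof -
  have x: "x \<in> tensor_power n" "\<And>i. deriv i x = 0" using assms by (simp_all add: mem_ker_R_iff)
  have "x * monomial [j] \<in> tensor_power (n + 1)"
    by (rule mult_in_tensor_power) (simp_all add: x)
  moreover have "monomial [j] * twist j x \<in> tensor_power (1 + n)"
    by (rule mult_in_tensor_power) (simp_all add: x twist_in_tensor_power)
  ultimately have "x * monomial [j] - monomial [j] * twist j x \<in> tensor_power (Suc n)"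
    by (simp add: tensor_power_closed)
  then show ?thesis by (simp only: mem_ker_R_iff deriv_commutator) (simp add: x)
qed

text \<open>
  For \<open>\<subseteq>\<close>, a preimage \<open>y = \<Sum>\<^sub>j x\<^sub>j e\<^sub>j\<close> of \<open>z\<close> under \<open>1 - T\<^sub>1 \<cdots> T\<^sub>n\<close> exists because the shift has no
  nonzero fixed vectors; applying \<open>D\<^sub>i\<close> turns \<open>\<Sum>\<^sub>j D\<^sub>i(x\<^sub>j) e\<^sub>j\<close> into a fixed vector of another such shift.
\<close>

lemma ker_R_Suc:
  assumes "n \<ge> 2"
  shows "ker_R q l (Suc n) = (\<lambda>x. x - T_prod q l n x) ` tensor_prod (ker_R q l n) (tensor_power 1)"
    (is "_ = ?g ` ?V")
proof
  show "?g ` ?V \<subseteq> ker_R q l (Suc n)"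
  proof (rule image_subsetI)
    fix z assume "z \<in> ?V"
    then show "?g z \<in> ker_R q l (Suc n)"
      unfolding tensor_prod_def
    proof (induct rule: free_alg.span_induct_alt)
      case base
      then show ?case by (simp add: free_alg.subspace_0[OF subspace_ker_R])
    next
      case (step c z y)
      then obtain u v where z: "z = u * v" and u: "u \<in> ker_R q l n" and v: "v \<in> tensor_power 1" by blast
      from v have "?g (u * v) \<in> ker_R q l (Suc n)"
      proof (induct v rule: tensor_power_induct)
        case zero
        then show ?case by (simp add: free_alg.subspace_0[OF subspace_ker_R])
      next
        case (add x y)
        then show ?case
          using free_alg.subspace_add[OF subspace_ker_R] by (fastforce simp: algebra_simps)
      next
        case (mono d w)
        then obtain j where w: "w = [j]" by (metis One_nat_def length_0_conv length_Suc_conv)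
        \<comment> \<open>Once \<open>T_prod\<close> is read as a shift, the image of
          \<open>u e_j\<close> is a twisted commutator with \<open>e_j\<close>.\<close>
        have "u * monomial [j] \<in> tensor_power (n + 1)"
          using u by (intro mult_in_tensor_power) (simp_all add: mem_ker_R_iff)
        then have "?g (u * monomial [j]) = u * monomial [j] - monomial [j] * twist j u"
          by (simp add: T_prod_eq_shift shift_tail_weight)
        then show ?case
          using generator_commutator_mem_ker_R[OF u, of j]
          by (simp add: w free_alg.subspace_scale[OF subspace_ker_R] flip: scal_simps(2))
      qed
      then have "scal c (?g z) + ?g y \<in> ker_R q l (Suc n)"
        using step z by (intro free_alg.subspace_add[OF subspace_ker_R] free_alg.subspace_scale[OF subspace_ker_R]) auto
      then show ?case by (simp add: algebra_simps)
    qed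
  qed
next
  show "ker_R q l (Suc n) \<subseteq> ?g ` ?V"
  proof
    fix z assume "z \<in> ker_R q l (Suc n)"
    then have z: "z \<in> tensor_power (Suc n)" and dz: "\<And>i. deriv i z = 0"
      by (simp_all add: mem_ker_R_iff)
    \<comment> \<open>The words here have length \<open>n + 1 >= 3\<close>, so the pigeonhole
      estimate applies.\<close>
    obtain y where y: "y \<in> tensor_power (Suc n)" and zy: "z = y - shift tail_weight y"
      using diff_shift_surj[OF contracting_tail_weight z] assms by auto
    define r where "r j = strip_right j y" for j
    have r: "r j \<in> tensor_power n" for j
      unfolding r_def by (rule strip_right_in_tensor_power[OF y])
    have yr: "y = r I1 * monomial [I1] + r I2 * monomial [I2]"
      unfolding r_def by (rule strip_right_expand[OF y])
    have "deriv i (r I1) = 0 \<and> deriv i (r I2) = 0" for i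
    proof -
      define N where "N = deriv i (r I1) * monomial [I1] + deriv i (r I2) * monomial [I2]"
      have "z = (r I1 * monomial [I1] - monomial [I1] * twist I1 (r I1))
          + (r I2 * monomial [I2] - monomial [I2] * twist I2 (r I2))"
        unfolding zy yr by (simp add: shift_tail_weight)
      then have "deriv i z = N - shift (deriv_tail_weight i) N"
        by (simp only: deriv_simps(3) deriv_commutator N_def shift_simps) simp
      then have "shift (deriv_tail_weight i) N = N" by (simp add: dz)
      moreover have "N \<in> tensor_power n"
      proof -
        obtain k where k: "n = Suc k" using assms by (cases n) auto
        have "deriv i (r j) * monomial [j] \<in> tensor_power (k + 1)" for j
          using r[of j] by (intro mult_in_tensor_power deriv_in_tensor_power) (simp_all add: k)
        then show ?thesis by (simp add: N_def k tensor_power_closed)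
      qed
      \<comment> \<open>\<open>N\<close> has degree only \<open>n >= 2\<close>, where the estimate
        for the enlarged weight still holds.\<close>
      ultimately have "N = 0"
        using shift_fixed_imp_zero[OF contracting_deriv_tail_weight] assms by blast
      then show ?thesis unfolding N_def using right_generators_eq_0 by blast
    qed
    then have "r j \<in> ker_R q l n" for j
      by (cases j) (auto simp: mem_ker_R_iff r)
    then have "y \<in> ?V"
      using yr mult_degree_one_mem_tensor_prod by metis
    moreover have "z = ?g y" using zy T_prod_eq_shift[OF y] by simp
    ultimately show "z \<in> ?g ` ?V" by blast
  qed
qed

lemma ker_R_eq_K_space: "m \<ge> 2 \<Longrightarrow> ker_R q l m = K_space q l m"
proof (induct m rule: nat_induct_at_least)
  case base
  then show ?case by (simp add: numeral_2_eq_2)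
next
  case (Suc n)
  then obtain k where "n = Suc (Suc k)" by (metis add_2_eq_Suc le_Suc_ex)
  with Suc show ?case by (simp add: ker_R_Suc)
qed

end

section \<open>Ideals of type-based rings\<close>

lemma ring_of_type_algebra_simps [simp]:
  "carrier ring_of_type_algebra = UNIV" "x \<otimes>\<^bsub>ring_of_type_algebra\<^esub> y = x * y"
  "x \<oplus>\<^bsub>ring_of_type_algebra\<^esub> y = x + y" "\<one>\<^bsub>ring_of_type_algebra\<^esub> = 1" "\<zero>\<^bsub>ring_of_type_algebra\<^esub> = 0"
  by (simp_all add: ring_of_type_algebra_def)

lemma ring_ring_of_type_algebra: "ring (ring_of_type_algebra :: 'a::ring_1 ring)"
proof -
  have "\<exists>y. x + y = 0" for x :: 'a
    using add.right_inverse by blast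
  then show ?thesis
    unfolding ring_of_type_algebra_def using add.right_inverse
    by unfold_locales (auto simp: algebra_simps Units_def)
qed

lemma a_inv_ring_of_type_algebra: "\<ominus>\<^bsub>ring_of_type_algebra\<^esub> x = - (x :: 'a::ring_1)"
  using ring.is_abelian_group[OF ring_ring_of_type_algebra]
  by (intro abelian_group.minus_equality) auto

lemma ideal_ring_of_type_algebra_iff:
  "ideal J (ring_of_type_algebra :: 'a::ring_1 ring) \<longleftrightarrow>
     0 \<in> J \<and> (\<forall>x\<in>J. \<forall>y\<in>J. x + y \<in> J) \<and> (\<forall>x\<in>J. \<forall>z. z * x \<in> J \<and> x * z \<in> J)"
  (is "?L \<longleftrightarrow> ?R")
proof
  assume I: ?L
  note A = ideal.axioms(1)[OF I]
  show ?R
    using additive_subgroup.zero_closed[OF A] additive_subgroup.a_closed[OF A]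
      ideal.I_l_closed[OF I] ideal.I_r_closed[OF I] by simp
next
  assume R: ?R
  show ?L
  proof (rule idealI[OF ring_ring_of_type_algebra])
    interpret G: group "add_monoid (ring_of_type_algebra :: 'a ring)"
      by (intro abelian_group.a_group ring.is_abelian_group ring_ring_of_type_algebra)
    show "subgroup J (add_monoid (ring_of_type_algebra :: 'a ring))"
    proof (rule G.subgroupI)
      fix a assume "a \<in> J"
      \<comment> \<open>Negation is multiplication by -1, so absorption covers it.\<close>
      then have "- 1 * a \<in> J" using R by blast
      then show "inv\<^bsub>add_monoid ring_of_type_algebra\<^esub> a \<in> J"
        using a_inv_ring_of_type_algebra[of a] by (simp add: a_inv_def)
    qed (use R in auto)
  qed (use R in auto)
qed

section \<open>The Fock representation\<close>

lemma star_superset: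
  assumes "finite A" "Poly_Mapping.keys x \<subseteq> A"
  shows "star x = (\<Sum>w\<in>A. scal (cnj (Poly_Mapping.lookup x w)) (monomial (rev (map gen_star (letters w)))))"
  unfolding star_def using assms
  by (intro sum.mono_neutral_left) (auto simp: in_keys_iff)

lemma star_add [simp]: "star (x + y) = star x + star y"
proof -
  let ?A = "Poly_Mapping.keys x \<union> Poly_Mapping.keys y"
  have "Poly_Mapping.keys (x + y) \<subseteq> ?A" by (rule keys_add)
  then show ?thesis
    by (simp add: star_superset[of ?A] lookup_add free_alg.scale_left_distrib sum.distrib)
qed

lemma star_scal [simp]: "star (scal c x) = scal (cnj c) (star x)"
proof -
  have "Poly_Mapping.keys (scal c x) \<subseteq> Poly_Mapping.keys x"
    by (auto simp: in_keys_iff lookup_scal)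
  then show ?thesis
    by (simp add: star_superset[of "Poly_Mapping.keys x"] lookup_scal scal_sum)
qed

lemma star_monomial [simp]: "star (monomial w) = monomial (rev (map gen_star w))"
  by (simp add: star_def monomial_def)

lemma star_zero [simp]: "star 0 = 0"
  by (simp add: star_def)

lemma star_one [simp]: "star 1 = 1"
  using star_monomial[of "[]"] by simp

lemma star_diff [simp]: "star (x - y) = star x - star y"
  using star_add[of "x - y" y] by (simp del: star_add)

lemma star_mult [simp]: "star (x * y) = star y * star x"
proof (induct x rule: free_alg_induct)
  case (mono c u)
  have "star (monomial u * y) = star y * star (monomial u)"
    by (induct y rule: free_alg_induct) (simp_all add: algebra_simps)
  then show ?case by simp
qed (simp_all add: algebra_simps)

lemma gen_star_gen_star [simp]: "gen_star (gen_star g) = g"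
  by (cases g) simp_all

lemma star_star [simp]: "star (star x) = x"
proof (induct x rule: free_alg_induct)
  case (mono c u)
  show ?case by (simp add: rev_map comp_def)
qed simp_all

text \<open>Taking \<open>h\<close> to be \<open>Cr\<close> or \<open>An\<close> treats words in the
  \<open>a_i\<close> and words in the \<open>a_i^*\<close> alike, keeping the order of
  letters.\<close>

definition relabel :: "(index \<Rightarrow> gen) \<Rightarrow> tensor \<Rightarrow> gen free_alg" where
  "relabel h = lin_ext (\<lambda>w. monomial (map h w))"

lemma relabel_simps [simp]:
  "relabel h 0 = 0" "relabel h 1 = 1" "relabel h (x + y) = relabel h x + relabel h y"
  "relabel h (x - y) = relabel h x - relabel h y" "relabel h (- x) = - relabel h x"
  "relabel h (scal c x) = scal c (relabel h x)" "relabel h (monomial w) = monomial (map h w)"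
  by (simp_all add: relabel_def)

lemma relabel_mult [simp]: "relabel h (x * y) = relabel h x * relabel h y"
  unfolding relabel_def by (rule lin_ext_mult) simp

section \<open>The action by creation and annihilation operators\<close>

context wick_params
begin

text \<open>With creation as left multiplication and annihilation as skew derivation, the Wick
  relations become the twisted Leibniz rule \<open>deriv_generator_mult\<close>.\<close>

primrec act_gen :: "gen \<Rightarrow> tensor \<Rightarrow> tensor" where
  "act_gen (Cr i) y = monomial [i] * y"
| "act_gen (An i) y = deriv i y"

definition act :: "gen free_alg \<Rightarrow> tensor \<Rightarrow> tensor" where
  "act x y = lin_ext (\<lambda>w. foldr act_gen w y) x"

lemma act_gen_linear: 
  "act_gen g (x + y) = act_gen g x + act_gen g y" "act_gen g (scal c x) = scal c (act_gen g x)"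
  "act_gen g 0 = 0"
  by (cases g; simp add: algebra_simps)+

lemma foldr_act_gen_linear: 
  "foldr act_gen w (x + y) = foldr act_gen w x + foldr act_gen w y"
  "foldr act_gen w (scal c x) = scal c (foldr act_gen w x)"
  "foldr act_gen w 0 = 0"
  by (induct w) (simp_all add: act_gen_linear)

lemma act_simps [simp]:
  "act 0 y = 0" "act 1 y = y" "act (x + z) y = act x y + act z y" "act (x - z) y = act x y - act z y"
  "act (scal c x) y = scal c (act x y)" "act (monomial w) y = foldr act_gen w y"
  by (simp_all add: act_def)

lemma act_linear_right [simp]:
  "act x (y + z) = act x y + act x z" "act x (scal c y) = scal c (act x y)" "act x 0 = 0"
  by (induct x rule: free_alg_induct) (simp_all add: foldr_act_gen_linear algebra_simps)

lemma act_mult [simp]: "act (x * z) y = act x (act z y)"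
proof (induct x rule: free_alg_induct)
  case (mono c u)
  have "act (monomial u * z) y = act (monomial u) (act z y)"
    by (induct z rule: free_alg_induct) (simp_all add: foldr_act_gen_linear algebra_simps)
  then show ?case by simp
qed (simp_all add: algebra_simps)

text \<open>
  The second conjunct makes the kernel \<open>*\<close>-closed by construction, so that the invariant form of
  the Fock representation, which may be degenerate, is not needed.
\<close>

definition fock_kernel :: "gen free_alg set" where
  "fock_kernel = {x. \<forall>y. act x y = 0 \<and> act (star x) y = 0}"

text \<open>The kernel is a star-closed two-sided ideal, so only the defining relations need
  checking; they and their adjoints act by zero through the Leibniz rule.\<close>

lemma relation_ideal_subset_fock_kernel: "relation_ideal q l \<subseteq> fock_kernel"
  unfolding relation_ideal_def
proof (rule hull_minimal)
  show "ideal fock_kernel free_ring \<and> star ` fock_kernel \<subseteq> fock_kernel"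
    by (auto simp: ideal_ring_of_type_algebra_iff fock_kernel_def)
  have "gen_a_star i * gen_a i - (1 + scal (of_real q) (gen_a i * gen_a_star i)) \<in> fock_kernel" for i
    by (auto simp: fock_kernel_def deriv_generator_mult coef_def)
  moreover have "gen_a_star I1 * gen_a I2 - scal l (gen_a I2 * gen_a_star I1) \<in> fock_kernel"
    by (auto simp: fock_kernel_def deriv_generator_mult coef_def)
  ultimately show "wick_relations q l \<subseteq> fock_kernel"
    by (auto simp: wick_relations_def)
qed

lemma act_relation_ideal: "x \<in> relation_ideal q l \<Longrightarrow> act x y = 0"
  using relation_ideal_subset_fock_kernel by (auto simp: fock_kernel_def)

section \<open>The quotient map onto the Wick algebra\<close>

lemma relation_ideal_props:
  "ideal (relation_ideal q l) free_ring \<and> star ` relation_ideal q l \<subseteq> relation_ideal q l"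
  unfolding relation_ideal_def
  \<comment> \<open>Being a star-closed ideal is stable under intersections, so the hull itself has
    the property.\<close>
  by (rule hull_in) (auto simp: ideal_ring_of_type_algebra_iff Ball_def image_subset_iff)

lemma relation_ideal_closed:
  "0 \<in> relation_ideal q l"
  "x \<in> relation_ideal q l \<Longrightarrow> y \<in> relation_ideal q l \<Longrightarrow> x + y \<in> relation_ideal q l"
  "x \<in> relation_ideal q l \<Longrightarrow> z * x \<in> relation_ideal q l"
  "x \<in> relation_ideal q l \<Longrightarrow> x * z \<in> relation_ideal q l"
  "x \<in> relation_ideal q l \<Longrightarrow> star x \<in> relation_ideal q l"
  using relation_ideal_props by (auto simp: ideal_ring_of_type_algebra_iff)

lemma relation_ideal_scal: "x \<in> relation_ideal q l \<Longrightarrow> scal c x \<in> relation_ideal q l"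
  using relation_ideal_closed(3)[of x "scal c 1"] by simp

lemma relation_ideal_diff:
  "x \<in> relation_ideal q l \<Longrightarrow> y \<in> relation_ideal q l \<Longrightarrow> x - y \<in> relation_ideal q l"
  using relation_ideal_closed(2)[of x "scal (- 1) y"] relation_ideal_scal[of y "- 1"]
  by (simp add: free_alg.scale_minus_left)

lemma wick_relation:
  "gen_a_star i * gen_a j - ((if i = j then 1 else 0) + scal (coef i j) (gen_a j * gen_a_star i))
     \<in> relation_ideal q l"
proof -
  have base: "x \<in> relation_ideal q l" if "x \<in> wick_relations q l" for x
    unfolding relation_ideal_def using that by (rule hull_inc)
  have same: "gen_a_star i * gen_a i - (1 + scal (of_real q) (gen_a i * gen_a_star i)) \<in> relation_ideal q l"
    by (rule base) (auto simp: wick_relations_def)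
  have r12: "gen_a_star I1 * gen_a I2 - scal l (gen_a I2 * gen_a_star I1) \<in> relation_ideal q l"
    by (rule base) (auto simp: wick_relations_def)
  \<comment> \<open>The relation for the reversed pair of indices is the adjoint of
    \<open>r12\<close>.\<close>
  have r21: "gen_a_star I2 * gen_a I1 - scal (cnj l) (gen_a I1 * gen_a_star I2) \<in> relation_ideal q l"
    using relation_ideal_closed(5)[OF r12] by simp
  show ?thesis
    by (cases i; cases j) (use same r12 r21 in \<open>simp_all add: coef_def\<close>)
qed

abbreviation cls :: "gen free_alg \<Rightarrow> gen free_alg set" where
  "cls \<equiv> wick_class q l"

abbreviation WA :: "gen free_alg set ring" where
  "WA \<equiv> wick_algebra q l"

sublocale cls: ring_hom_ring free_ring WA cls
proof -
  interpret ideal "relation_ideal q l" free_ring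
    using relation_ideal_props by simp
  have "cls = (+>\<^bsub>free_ring\<^esub>) (relation_ideal q l)"
    by (rule ext) (simp add: wick_class_def)
  then show "ring_hom_ring free_ring WA cls"
    using rcos_ring_hom_ring by (simp add: wick_algebra_def)
qed

lemma cls_hom:
  "cls (x + y) = cls x \<oplus>\<^bsub>WA\<^esub> cls y" "cls (x * y) = cls x \<otimes>\<^bsub>WA\<^esub> cls y"
  "cls 1 = \<one>\<^bsub>WA\<^esub>" "cls 0 = \<zero>\<^bsub>WA\<^esub>" "cls (- x) = \<ominus>\<^bsub>WA\<^esub> cls x" "cls x \<in> carrier WA"
  using cls.hom_add[of x y] cls.hom_mult[of x y] cls.hom_one cls.hom_zero cls.hom_a_inv[of x]
    cls.hom_closed[of x]
  by (simp_all add: a_inv_ring_of_type_algebra)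

lemma cls_eq_iff: "cls x = cls y \<longleftrightarrow> x - y \<in> relation_ideal q l"
proof -
  have mem: "z \<in> cls x \<longleftrightarrow> z - x \<in> relation_ideal q l" for z x
  proof -
    have "z \<in> cls x \<longleftrightarrow> (\<exists>h\<in>relation_ideal q l. z = h + x)"
      by (simp add: wick_class_def a_r_coset_def')
    also have "\<dots> \<longleftrightarrow> z - x \<in> relation_ideal q l"
      by (metis add_diff_cancel diff_add_cancel)
    finally show ?thesis .
  qed
  show ?thesis
  proof
    assume "cls x = cls y"
    moreover have "x \<in> cls x" by (simp add: mem relation_ideal_closed)
    ultimately show "x - y \<in> relation_ideal q l" by (simp add: mem)
  next
    assume xy: "x - y \<in> relation_ideal q l"
    have "z - x \<in> relation_ideal q l \<longleftrightarrow> z - y \<in> relation_ideal q l" for z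
      using relation_ideal_closed(2)[OF _ xy, of "z - x"] relation_ideal_diff[OF _ xy, of "z - y"] by auto
    then show "cls x = cls y" using mem by blast
  qed
qed

lemma cls_scal: "cls (scal c x) = cls (scal c 1) \<otimes>\<^bsub>WA\<^esub> cls x"
  by (simp flip: cls_hom)

section \<open>Subspaces of the Wick algebra and their lifts\<close>

lemma subalgebra_cls_image:
  assumes "free_alg.subspace S"
  shows "subalgebra (scalars q l) (cls ` S) WA"
proof (intro subalgebra.intro subalgebra_axioms.intro)
  show "subgroup (cls ` S) (add_monoid WA)"
  proof (rule group.subgroupI)
    show "group (add_monoid WA)" by (rule cls.S.a_group)
    show "cls ` S \<noteq> {}" using free_alg.subspace_0[OF assms] by blast
    fix a assume "a \<in> cls ` S"
    then show "inv\<^bsub>add_monoid WA\<^esub> a \<in> cls ` S"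
      using free_alg.subspace_neg[OF assms] cls_hom(5) by (auto simp: a_inv_def)
  next
    fix a b assume "a \<in> cls ` S" "b \<in> cls ` S"
    then show "a \<otimes>\<^bsub>add_monoid WA\<^esub> b \<in> cls ` S"
      using free_alg.subspace_add[OF assms] by (auto simp flip: cls_hom)
  qed (auto simp: cls_hom)
next
  fix k v assume "k \<in> scalars q l" "v \<in> cls ` S"
  then show "k \<otimes>\<^bsub>WA\<^esub> v \<in> cls ` S"
    using free_alg.subspace_scale[OF assms] by (auto simp: scalars_def simp flip: cls_scal)
qed

lemma subspace_cls_vimage:
  assumes "subalgebra (scalars q l) W WA"
  shows "free_alg.subspace {x. cls x \<in> W}"
proof -
  interpret subalgebra "scalars q l" W WA by fact
  have "cls (scal c x) \<in> W" if "cls x \<in> W" for c x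
    unfolding cls_scal[of c x] by (rule smult_closed) (use that in \<open>auto simp: scalars_def\<close>)
  moreover have "cls 0 \<in> W" using one_closed by (simp add: cls_hom)
  moreover have "cls (x + y) \<in> W" if "cls x \<in> W" "cls y \<in> W" for x y
    using m_closed that by (simp add: cls_hom)
  ultimately show ?thesis
    unfolding free_alg.subspace_def by auto
qed

text \<open>Images and preimages of subspaces under \<open>cls\<close> are subspaces, giving one
  inclusion each. Inclusions between products can then be checked on representatives, up to
  relations.\<close>

lemma wick_prod_cls_image:
  "wick_prod q l (cls ` U) (cls ` V) = cls ` free_alg.span {u * v |u v. u \<in> U \<and> v \<in> V}"
  (is "?L = cls ` free_alg.span ?B")
proof
  show "?L \<subseteq> cls ` free_alg.span ?B"
    unfolding wick_prod_def
  proof (rule hull_minimal)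
    show "subalgebra (scalars q l) (cls ` free_alg.span ?B) WA"
      by (rule subalgebra_cls_image) (rule free_alg.subspace_span)
    show "{u \<otimes>\<^bsub>WA\<^esub> v |u v. u \<in> cls ` U \<and> v \<in> cls ` V} \<subseteq> cls ` free_alg.span ?B"
      using free_alg.span_base[of _ ?B] by (fastforce simp flip: cls_hom)
  qed
  show "cls ` free_alg.span ?B \<subseteq> ?L"
    unfolding wick_prod_def hull_def
  proof (rule Inter_greatest)
    fix W assume "W \<in> {W. subalgebra (scalars q l) W WA \<and>
        {u \<otimes>\<^bsub>WA\<^esub> v |u v. u \<in> cls ` U \<and> v \<in> cls ` V} \<subseteq> W}"
    then have sub: "free_alg.subspace {x. cls x \<in> W}" and B: "?B \<subseteq> {x. cls x \<in> W}"
      by (fastforce simp: cls_hom intro: subspace_cls_vimage)+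
    show "cls ` free_alg.span ?B \<subseteq> W"
      using free_alg.span_minimal[OF B sub] by auto
  qed
qed

text \<open>A general letter map \<open>h\<close> covers \<open>TH\<close> and
  \<open>TH_star\<close> by one argument.\<close>

lemma generate_ring_generators:
  "generate_ring WA (scalars q l \<union> range (\<lambda>i. cls (monomial [h i]))) = cls ` range (relabel h)"
  (is "generate_ring WA ?H = ?S")
proof
  have H: "?H \<subseteq> ?S"
  proof -
    have "scal c 1 = relabel h (scal c 1)" for c by simp
    moreover have "monomial [h i] = relabel h (monomial [i])" for i by simp
    ultimately show ?thesis unfolding scalars_def by blast
  qed
  show "generate_ring WA ?H \<subseteq> ?S"
  proof
    fix z assume "z \<in> generate_ring WA ?H"
    then show "z \<in> ?S"
    proof induct
      case one
      have "cls (relabel h 1) \<in> ?S" by blast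
      then show ?case by (simp add: cls_hom)
    next
      case (incl z)
      then show ?case using H by blast
    next
      case (a_inv z)
      then obtain x where "z = cls (relabel h x)" by blast
      then have "\<ominus>\<^bsub>WA\<^esub> z = cls (relabel h (- x))" by (simp add: cls_hom)
      then show ?case by blast
    next
      case (eng_add z z')
      then obtain x x' where "z = cls (relabel h x)" "z' = cls (relabel h x')" by blast
      then have "z \<oplus>\<^bsub>WA\<^esub> z' = cls (relabel h (x + x'))" by (simp add: cls_hom)
      then show ?case by blast
    next
      case (eng_mult z z')
      then obtain x x' where "z = cls (relabel h x)" "z' = cls (relabel h x')" by blast
      then have "z \<otimes>\<^bsub>WA\<^esub> z' = cls (relabel h (x * x'))" by (simp add: cls_hom)
      then show ?case by blast
    qed
  qed
  have "cls (relabel h x) \<in> generate_ring WA ?H" for x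
  proof (induct x rule: free_alg_induct)
    case zero
    have "\<zero>\<^bsub>WA\<^esub> \<in> generate_ring WA ?H" by (rule cls.S.zero_in_generate)
    then show ?case by (simp add: cls_hom)
  next
    case (add x y)
    then show ?case by (simp add: cls_hom generate_ring.eng_add)
  next
    case (mono c w)
    have "cls (monomial (map h w)) \<in> generate_ring WA ?H"
    proof (induct w)
      case Nil
      show ?case by (simp add: cls_hom generate_ring.one)
    next
      case (Cons j w)
      have "cls (monomial [h j]) \<otimes>\<^bsub>WA\<^esub> cls (monomial (map h w)) \<in> generate_ring WA ?H"
        by (rule generate_ring.eng_mult[OF _ Cons]) (auto intro: generate_ring.incl)
      then show ?case by (simp flip: cls_hom)
    qed
    moreover have "cls (scal c 1) \<in> generate_ring WA ?H"
      by (rule generate_ring.incl) (auto simp: scalars_def)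
    ultimately show ?case
      by (simp add: cls_scal[of c "monomial _"] generate_ring.eng_mult)
  qed
  then show "?S \<subseteq> generate_ring WA ?H" by blast
qed

lemma TH_eq: "TH q l = cls ` range (relabel Cr)"
  unfolding TH_def by (rule generate_ring_generators)

lemma TH_star_eq: "TH_star q l = cls ` range (relabel An)"
  unfolding TH_star_def by (rule generate_ring_generators)

lemma wick_embed_eq: "wick_embed q l x = cls (relabel Cr x)"
  by (simp add: wick_embed_def relabel_def)

lemma ring_TH_ring: "ring (TH_ring q l)"
  unfolding TH_def
  by (rule cls.S.generate_ring_is_ring) (auto simp: scalars_def cls_hom)

section \<open>Two-sided ideals of the tensor algebra\<close>

definition ideal_span :: "tensor set \<Rightarrow> tensor set" where
  "ideal_span B = free_alg.span {u * x * v |u x v. x \<in> B}"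

lemma subspace_ideal_span: "free_alg.subspace (ideal_span B)"
  unfolding ideal_span_def by (rule free_alg.subspace_span)

lemma ideal_span_base: "x \<in> B \<Longrightarrow> u * x * v \<in> ideal_span B"
  unfolding ideal_span_def by (rule free_alg.span_base) blast

lemma ideal_span_superset: "B \<subseteq> ideal_span B"
  using ideal_span_base[of _ B 1 1] by auto

lemma ideal_span_minimal:
  assumes "free_alg.subspace S" "\<And>u x v. x \<in> B \<Longrightarrow> u * x * v \<in> S"
  shows "ideal_span B \<subseteq> S"
  unfolding ideal_span_def by (rule free_alg.span_minimal) (use assms in auto)

lemma ideal_span_mult:
  assumes "x \<in> ideal_span B"
  shows "y * x * z \<in> ideal_span B"
proof -
  have "free_alg.subspace {x. y * x * z \<in> ideal_span B}"
    using subspace_ideal_span[of B] unfolding free_alg.subspace_def by (auto simp: algebra_simps)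
  moreover have "y * (u * x * v) * z \<in> ideal_span B" if "x \<in> B" for u x v
    using ideal_span_base[OF that, of "y * u" "v * z"] by (simp add: mult.assoc)
  ultimately show ?thesis
    using ideal_span_minimal[of "{x. y * x * z \<in> ideal_span B}" B] assms by auto
qed

lemma ideal_span_mult_left: "x \<in> ideal_span B \<Longrightarrow> y * x \<in> ideal_span B"
  and ideal_span_mult_right: "x \<in> ideal_span B \<Longrightarrow> x * z \<in> ideal_span B"
  using ideal_span_mult[of x B y 1] ideal_span_mult[of x B 1 z] by simp_all

lemma ideal_cls_image:
  assumes S: "free_alg.subspace S" and l: "\<And>x y. x \<in> S \<Longrightarrow> y * x \<in> S" and r: "\<And>x y. x \<in> S \<Longrightarrow> x * y \<in> S"
  shows "ideal (cls ` relabel Cr ` S) (TH_ring q l)"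
proof (rule idealI[OF ring_TH_ring])
  interpret R: ring "TH_ring q l" by (rule ring_TH_ring)
  have minus: "\<ominus>\<^bsub>TH_ring q l\<^esub> cls (relabel Cr x) = cls (relabel Cr (- x))" for x
    by (rule R.minus_equality) (auto simp: TH_eq simp del: relabel_simps(5) simp flip: cls_hom relabel_simps(3))
  show "subgroup (cls ` relabel Cr ` S) (add_monoid (TH_ring q l))"
  proof (rule group.subgroupI[OF R.a_group])
    show "cls ` relabel Cr ` S \<noteq> {}" using free_alg.subspace_0[OF S] by blast
    fix a assume "a \<in> cls ` relabel Cr ` S"
    then show "inv\<^bsub>add_monoid (TH_ring q l)\<^esub> a \<in> cls ` relabel Cr ` S"
      using free_alg.subspace_neg[OF S] minus
      by (auto simp: a_inv_def simp del: relabel_simps(5))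
  next
    fix a b assume "a \<in> cls ` relabel Cr ` S" "b \<in> cls ` relabel Cr ` S"
    then show "a \<otimes>\<^bsub>add_monoid (TH_ring q l)\<^esub> b \<in> cls ` relabel Cr ` S"
      using free_alg.subspace_add[OF S] by (auto simp flip: cls_hom relabel_simps(3))
  qed (auto simp: TH_eq)
  fix a x assume "a \<in> cls ` relabel Cr ` S" "x \<in> carrier (TH_ring q l)"
  then show "x \<otimes>\<^bsub>TH_ring q l\<^esub> a \<in> cls ` relabel Cr ` S" "a \<otimes>\<^bsub>TH_ring q l\<^esub> x \<in> cls ` relabel Cr ` S"
    using l r by (auto simp: TH_eq simp flip: cls_hom relabel_mult)
qed

text \<open>This replaces the abstract ideal by an explicit span in the tensor algebra, where
  degrees and derivations are available. For the reverse inclusion, the preimage of the ideal is a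
  subspace absorbing products.\<close>

lemma generated_ideal_eq: "generated_ideal q l B = cls ` relabel Cr ` ideal_span B"
proof
  interpret R: ring "TH_ring q l" by (rule ring_TH_ring)
  have carr: "wick_embed q l ` B \<subseteq> carrier (TH_ring q l)"
    by (auto simp: wick_embed_eq TH_eq)
  show "generated_ideal q l B \<subseteq> cls ` relabel Cr ` ideal_span B"
    unfolding generated_ideal_def
  proof (rule R.genideal_minimal)
    show "ideal (cls ` relabel Cr ` ideal_span B) (TH_ring q l)"
      by (intro ideal_cls_image subspace_ideal_span ideal_span_mult_left ideal_span_mult_right)
    show "wick_embed q l ` B \<subseteq> cls ` relabel Cr ` ideal_span B"
      using ideal_span_superset by (auto simp: wick_embed_eq)
  qed
  interpret I: ideal "generated_ideal q l B" "TH_ring q l"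
    unfolding generated_ideal_def by (rule R.genideal_ideal[OF carr])
  let ?S = "{x. cls (relabel Cr x) \<in> generated_ideal q l B}"
  have left: "cls (relabel Cr (y * x)) \<in> generated_ideal q l B"
    and right: "cls (relabel Cr (x * y)) \<in> generated_ideal q l B"
    if "cls (relabel Cr x) \<in> generated_ideal q l B" for x y
    using I.I_l_closed[OF that, of "cls (relabel Cr y)"] I.I_r_closed[OF that, of "cls (relabel Cr y)"]
    by (auto simp: TH_eq cls_hom)
  have "ideal_span B \<subseteq> ?S"
  proof (rule ideal_span_minimal)
    \<comment> \<open>Scalar multiples come from absorbing \<open>scal c 1\<close>, which represents
      an element of \<open>TH\<close>.\<close>
    have "cls (relabel Cr (scal c x)) \<in> generated_ideal q l B"
      if "cls (relabel Cr x) \<in> generated_ideal q l B" for c x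
      using left[OF that, of "scal c 1"] by simp
    then show "free_alg.subspace ?S"
      unfolding free_alg.subspace_def using I.zero_closed I.a_closed by (auto simp: cls_hom)
    fix u x v assume "x \<in> B"
    then have "cls (relabel Cr x) \<in> generated_ideal q l B"
      using R.genideal_self[OF carr] by (auto simp: generated_ideal_def wick_embed_eq)
    then show "u * x * v \<in> ?S" using left right by blast
  qed
  then show "cls ` relabel Cr ` ideal_span B \<subseteq> generated_ideal q l B" by blast
qed

section \<open>Wick ideals\<close>

lemma annihilator_commutation:
  "gen_a_star i * relabel Cr x - (relabel Cr (deriv i x) + relabel Cr (twist i x) * gen_a_star i)
     \<in> relation_ideal q l"
proof (induct x rule: free_alg_induct)
  case zero
  then show ?case by (simp add: relation_ideal_closed)
next
  case (add x y)
  from relation_ideal_closed(2)[OF this] show ?case by (simp add: algebra_simps)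
next
  case (mono c w)
  define E where "E w = gen_a_star i * monomial (map Cr w)
    - (relabel Cr (deriv_word i w) + scal (weight i w) (monomial (map Cr w) * gen_a_star i))" for w
  have "E w \<in> relation_ideal q l"
  proof (induct w)
    case Nil
    then show ?case by (simp add: E_def relation_ideal_closed)
  next
    case (Cons j w)
    \<comment> \<open>The error for \<open>j # w\<close> splits into a basic relation times the
      remaining word and a multiple of \<open>a_j\<close> times the error for
      \<open>w\<close>.\<close>
    have "E (j # w) = (gen_a_star i * gen_a j
          - ((if i = j then 1 else 0) + scal (coef i j) (gen_a j * gen_a_star i))) * monomial (map Cr w)
        + scal (coef i j) (gen_a j * E w)"
      by (simp add: E_def algebra_simps flip: mult.assoc)
    then show ?case
      using relation_ideal_closed(2)[OF relation_ideal_closed(4)[OF wick_relation]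
          relation_ideal_scal[OF relation_ideal_closed(3)[OF Cons]]] by simp
  qed
  from relation_ideal_scal[OF this, of c] show ?case by (simp add: E_def)
qed

lemma ideal_span_ker_R_closed:
  assumes "x \<in> ideal_span (ker_R q l m)"
  shows "deriv i x \<in> ideal_span (ker_R q l m)" "twist i x \<in> ideal_span (ker_R q l m)"
proof -
  let ?I = "ideal_span (ker_R q l m)"
  have "?I \<subseteq> {x. deriv i x \<in> ?I \<and> twist i x \<in> ?I}"
  proof (rule ideal_span_minimal)
    show "free_alg.subspace {x. deriv i x \<in> ?I \<and> twist i x \<in> ?I}"
      using subspace_ideal_span[of "ker_R q l m"] unfolding free_alg.subspace_def by auto
    fix u x v assume x: "x \<in> ker_R q l m"
    have tx: "twist i x \<in> ker_R q l m" by (rule twist_ker_R[OF x])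
    \<comment> \<open>The term with \<open>deriv i x\<close> is absent because \<open>x\<close> lies
      in the kernel; the others still contain \<open>x\<close> or \<open>twist i x\<close>.\<close>
    have "deriv i (u * x * v) = deriv i u * x * v + twist i u * twist i x * deriv i v"
      using x by (simp add: deriv_mult mem_ker_R_iff algebra_simps)
    then show "u * x * v \<in> {x. deriv i x \<in> ?I \<and> twist i x \<in> ?I}"
      using ideal_span_base[OF x] ideal_span_base[OF tx]
      by (simp add: free_alg.subspace_add[OF subspace_ideal_span])
  qed
  with assms show "deriv i x \<in> ?I" "twist i x \<in> ?I" by auto
qed

lemma wick_ideal_ker_R: "wick_ideal q l (generated_ideal q l (ker_R q l m))"
proof -
  let ?I = "ideal_span (ker_R q l m)"
  \<comment> \<open>\<open>M\<close> consists of normally ordered sums, ideal elements standing left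
    of words in the \<open>a_i^*\<close>; \<open>M'\<close> is \<open>M\<close> plus the relation
    ideal.\<close>
  define M where "M = free_alg.span {u * v |u v. u \<in> relabel Cr ` ?I \<and> v \<in> range (relabel An)}"
  define M' where "M' = {z. \<exists>y\<in>M. z - y \<in> relation_ideal q l}"
  have M: "free_alg.subspace M" unfolding M_def by (rule free_alg.subspace_span)
  have M_base: "relabel Cr x * relabel An y \<in> M" if "x \<in> ?I" for x y
    unfolding M_def using that by (intro free_alg.span_base) blast
  have M': "free_alg.subspace M'"
    unfolding free_alg.subspace_def
  proof (intro conjI ballI allI)
    show "0 \<in> M'" using free_alg.subspace_0[OF M] by (auto simp: M'_def relation_ideal_closed intro!: bexI[of _ 0])
  next
    fix x y assume "x \<in> M'" "y \<in> M'"
    then obtain x' y' where *: "x' \<in> M" "y' \<in> M" "x - x' \<in> relation_ideal q l" "y - y' \<in> relation_ideal q l"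
      by (auto simp: M'_def)
    show "x + y \<in> M'"
      unfolding M'_def using relation_ideal_closed(2)[OF *(3,4)] free_alg.subspace_add[OF M *(1,2)]
      by (auto simp: algebra_simps intro!: bexI[of _ "x' + y'"])
  next
    fix c x assume "x \<in> M'"
    then obtain x' where *: "x' \<in> M" "x - x' \<in> relation_ideal q l" by (auto simp: M'_def)
    show "scal c x \<in> M'"
      unfolding M'_def using relation_ideal_scal[OF *(2), of c] free_alg.subspace_scale[OF M *(1)]
      by (auto intro!: bexI[of _ "scal c x'"])
  qed
  have step_M: "gen_a_star i * z \<in> M'" if "z \<in> M" for i z
  proof -
    have "M \<subseteq> {z. gen_a_star i * z \<in> M'}"
      unfolding M_def
    proof (rule free_alg.span_minimal)
      show "free_alg.subspace {z. gen_a_star i * z \<in> M'}"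
        using M' unfolding free_alg.subspace_def by (auto simp: algebra_simps)
      show "{u * v |u v. u \<in> relabel Cr ` ?I \<and> v \<in> range (relabel An)} \<subseteq> {z. gen_a_star i * z \<in> M'}"
      proof clarify
        fix x y assume x: "x \<in> ?I"
        \<comment> \<open>Moving \<open>a_i^*\<close> past \<open>x\<close> keeps the left factors
          in the ideal; the leftover \<open>a_i^*\<close> is absorbed into \<open>y\<close>.\<close>
        have "relabel Cr (deriv i x) * relabel An y
            + relabel Cr (twist i x) * relabel An (monomial [i] * y) \<in> M"
          by (intro free_alg.subspace_add[OF M] M_base ideal_span_ker_R_closed x)
        then show "gen_a_star i * (relabel Cr x * relabel An y) \<in> M'"
          using relation_ideal_closed(4)[OF annihilator_commutation[of i x], of "relabel An y"]
          unfolding M'_def by (auto simp: algebra_simps intro!: bexI)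
      qed
    qed
    with that show ?thesis by auto
  qed
  have step: "gen_a_star i * z \<in> M'" if "z \<in> M'" for i z
  proof -
    from that obtain y where y: "y \<in> M" "z - y \<in> relation_ideal q l" by (auto simp: M'_def)
    have "gen_a_star i * z - gen_a_star i * y \<in> M'"
      using relation_ideal_closed(3)[OF y(2), of "gen_a_star i"] free_alg.subspace_0[OF M]
      by (auto simp: M'_def algebra_simps intro!: bexI[of _ 0])
    then show ?thesis using free_alg.subspace_add[OF M' _ step_M[OF y(1), of i]] by fastforce
  qed
  have prod: "relabel An y * relabel Cr x \<in> M'" if x: "x \<in> ?I" for x y
  proof (induct y rule: free_alg_induct)
    case zero
    then show ?case by (simp add: free_alg.subspace_0[OF M'])
  next
    case (add y z)
    then show ?case by (simp add: algebra_simps free_alg.subspace_add[OF M'])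
  next
    case (mono c w)
    have "monomial (map An w) * relabel Cr x \<in> M'"
    proof (induct w)
      case Nil
      show ?case using M_base[OF x, of 1] by (auto simp: M'_def relation_ideal_closed intro!: bexI)
    next
      case (Cons j w)
      then show ?case using step[OF Cons, of j] by (simp flip: mult.assoc)
    qed
    then show ?case by (simp add: free_alg.subspace_scale[OF M'])
  qed
  have "cls ` M' \<subseteq> cls ` M"
    by (auto simp: M'_def image_iff cls_eq_iff)
  moreover have "free_alg.span {u * v |u v. u \<in> range (relabel An) \<and> v \<in> relabel Cr ` ?I} \<subseteq> M'"
    by (rule free_alg.span_minimal[OF _ M']) (use prod in auto)
  ultimately have "wick_prod q l (TH_star q l) (generated_ideal q l (ker_R q l m))
      \<subseteq> wick_prod q l (generated_ideal q l (ker_R q l m)) (TH_star q l)"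
    unfolding generated_ideal_eq TH_star_eq wick_prod_cls_image M_def[symmetric] by blast
  moreover have "ideal (generated_ideal q l (ker_R q l m)) (TH_ring q l)"
    unfolding generated_ideal_eq
    by (intro ideal_cls_image subspace_ideal_span ideal_span_mult_left ideal_span_mult_right)
  ultimately show ?thesis by (simp add: wick_ideal_def)
qed

section \<open>Maximality of the ideal generated by the kernel\<close>

lemma act_relabel_Cr: "act (relabel Cr x) y = x * y"
proof (induct x rule: free_alg_induct)
  case (mono c w)
  have "foldr act_gen (map Cr w) y = monomial w * y"
    by (induct w) (simp_all flip: mult.assoc)
  then show ?case by simp
qed (simp_all add: algebra_simps)

text \<open>Derivations kill the unit, so on the vacuum only the empty word survives.\<close>

lemma act_relabel_An_vacuum: "\<exists>c. act (relabel An y) 1 = scal c 1"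
proof (induct y rule: free_alg_induct)
  case zero
  show ?case by (auto intro: exI[of _ 0])
next
  case (add x y)
  then show ?case by (auto simp flip: free_alg.scale_left_distrib)
next
  case (mono c w)
  have "foldr act_gen (map An w) 1 = scal (if w = [] then 1 else 0) 1"
    by (induct w) (simp_all)
  then show ?case by auto
qed

text \<open>Multiplication cannot lower degree, so the ideal is supported on words longer than
  \<open>n\<close>, while \<open>x\<close> is supported on words of length \<open>n\<close>.\<close>

lemma ideal_span_tensor_power:
  assumes B: "B \<subseteq> tensor_power (Suc n)" and x: "x \<in> ideal_span B" and n: "x \<in> tensor_power n"
  shows "x = 0"
proof -
  define S :: "tensor set" where "S = {x. \<forall>w. length w \<le> n \<longrightarrow> Poly_Mapping.lookup x (FM w) = 0}"
  have S: "free_alg.subspace S"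
    unfolding free_alg.subspace_def S_def by (auto simp: lookup_add lookup_scal)
  have mono_S: "monomial w \<in> S" if "n < length w" for w
    using that by (auto simp: S_def lookup_monomial)
  have "ideal_span B \<subseteq> S"
  proof (rule ideal_span_minimal[OF S])
    fix u x v :: tensor assume "x \<in> B"
    then have "x \<in> tensor_power (Suc n)" using B by blast
    then show "u * x * v \<in> S"
    proof (induct x rule: tensor_power_induct)
      case zero
      show ?case by (simp add: free_alg.subspace_0[OF S])
    next
      case (add x y)
      then show ?case by (simp add: algebra_simps free_alg.subspace_add[OF S])
    next
      case (mono c w)
      have "u * monomial w * v \<in> S"
      proof (induct u rule: free_alg_induct)
        case zero
        show ?case by (simp add: free_alg.subspace_0[OF S])
      next
        case (add x y)
        then show ?case by (simp add: algebra_simps free_alg.subspace_add[OF S])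
      next
        case (mono d u)
        have "monomial (u @ w) * v \<in> S"
        proof (induct v rule: free_alg_induct)
          case zero
          show ?case by (simp add: free_alg.subspace_0[OF S])
        next
          case (add x y)
          then show ?case by (simp add: algebra_simps free_alg.subspace_add[OF S])
        next
          case (mono d v)
          then show ?case
            using mono_S[of "u @ w @ v"] \<open>length w = Suc n\<close> by (simp add: free_alg.subspace_scale[OF S])
        qed
        then show ?case by (simp add: free_alg.subspace_scale[OF S])
      qed
      then show ?case by (simp add: free_alg.subspace_scale[OF S])
    qed
  qed
  with x have "x \<in> S" by blast
  show ?thesis
  proof (rule poly_mapping_eqI)
    fix w
    show "Poly_Mapping.lookup x w = Poly_Mapping.lookup 0 w"
      using \<open>x \<in> S\<close> n by (cases w) (force simp: S_def tensor_power_def in_keys_iff)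
  qed
qed

text \<open>
  In \<open>a\<^sub>i\<^sup>* x = D\<^sub>i(x) + \<sigma>\<^sub>i(x) a\<^sub>i\<^sup>*\<close> evaluation on the vacuum isolates \<open>D\<^sub>i(x)\<close>, which then lies in the ideal but
  has too small a degree.
\<close>

lemma homogeneous_wick_ideal_subset_ker_R:
  assumes "n > 0" "B \<subseteq> tensor_power n" "wick_ideal q l (generated_ideal q l B)"
  shows "B \<subseteq> ker_R q l n"
proof
  fix x assume x: "x \<in> B"
  let ?I = "ideal_span B"
  let ?M = "free_alg.span {u * v |u v. u \<in> relabel Cr ` ?I \<and> v \<in> range (relabel An)}"
  obtain k where k: "n = Suc k" using assms(1) by (cases n) auto
  have xn: "x \<in> tensor_power (Suc k)" using assms(2) x k by blast
  have act_M: "act z 1 \<in> ?I" if "z \<in> ?M" for z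
  proof -
    have "?M \<subseteq> {z. act z 1 \<in> ?I}"
    proof (rule free_alg.span_minimal)
      show "free_alg.subspace {z. act z 1 \<in> ?I}"
        using subspace_ideal_span[of B] unfolding free_alg.subspace_def by auto
      show "{u * v |u v. u \<in> relabel Cr ` ?I \<and> v \<in> range (relabel An)} \<subseteq> {z. act z 1 \<in> ?I}"
      proof clarify
        fix x y assume "x \<in> ?I"
        moreover obtain c where "act (relabel An y) 1 = scal c 1" using act_relabel_An_vacuum by blast
        ultimately show "act (relabel Cr x * relabel An y) 1 \<in> ?I"
          by (simp add: act_relabel_Cr free_alg.subspace_scale[OF subspace_ideal_span])
      qed
    qed
    with that show ?thesis by blast
  qed
  have "deriv i x = 0" for i
  proof -
    have "relabel An (monomial [i]) * relabel Cr x
        \<in> free_alg.span {u * v |u v. u \<in> range (relabel An) \<and> v \<in> relabel Cr ` ?I}"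
      using x ideal_span_superset by (intro free_alg.span_base) blast
    then have "cls (gen_a_star i * relabel Cr x) \<in> cls ` ?M"
      using assms(3) unfolding wick_ideal_def generated_ideal_eq TH_star_eq wick_prod_cls_image by auto
    then obtain z where z: "z \<in> ?M" "gen_a_star i * relabel Cr x - z \<in> relation_ideal q l"
      by (auto simp: cls_eq_iff)
    \<comment> \<open>The relation ideal acts by zero, so \<open>z\<close> and
      \<open>a_i^* x\<close> agree on the vacuum.\<close>
    have "deriv i x = act z 1"
      using act_relation_ideal[OF z(2), of 1] by (simp add: act_relabel_Cr)
    then have "deriv i x \<in> ?I" using act_M[OF z(1)] by simp
    then show ?thesis
      using assms(2) k deriv_in_tensor_power[OF xn] by (intro ideal_span_tensor_power[of B k]) auto
  qed
  then show "x \<in> ker_R q l n" using xn k by (simp add: mem_ker_R_iff)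
qed

lemma largest_homogeneous_wick_ideal_ker_R:
  assumes "n > 0"
  shows "largest_homogeneous_wick_ideal q l n (generated_ideal q l (ker_R q l n))"
proof -
  have "homogeneous_wick_ideal q l n (generated_ideal q l (ker_R q l n))"
    unfolding homogeneous_wick_ideal_def using wick_ideal_ker_R subspace_ker_R
    by (auto simp: mem_ker_R_iff intro!: exI[of _ "ker_R q l n"])
  moreover have "I' \<subseteq> generated_ideal q l (ker_R q l n)" if "homogeneous_wick_ideal q l n I'" for I'
  proof -
    from that obtain B where B: "wick_ideal q l I'" "B \<subseteq> tensor_power n" "I' = generated_ideal q l B"
      by (auto simp: homogeneous_wick_ideal_def)
    then have "B \<subseteq> ker_R q l n" using homogeneous_wick_ideal_subset_ker_R[OF assms] by blast
    then have "ideal_span B \<subseteq> ideal_span (ker_R q l n)"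
      by (intro ideal_span_minimal subspace_ideal_span ideal_span_base) blast
    then show ?thesis by (auto simp: B(3) generated_ideal_eq)
  qed
  ultimately show ?thesis by (simp add: largest_homogeneous_wick_ideal_def)
qed

end

theorem proposition7:
  fixes q :: real and l :: complex and m :: nat
  assumes "0 < q" and "q < 1" and "cmod l = 1" and "m \<ge> 2"
  shows "ker_R q l m = K_space q l m
         \<and> largest_homogeneous_wick_ideal q l m (generated_ideal q l (ker_R q l m))"
proof -
  interpret wick_params q l
    using assms by unfold_locales
  show ?thesis
    using ker_R_eq_K_space[OF assms(4)] largest_homogeneous_wick_ideal_ker_R[of m] assms(4) by simp
qed

end
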